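(* Let $q\geq 2$ and $n\geq 0$ be integers, let $\eta\in(0,1)$, and let $(\Xi,\mathcal{Z})$ be a compatible pair consisting of a finite set $\Xi\subseteq\mathbb{S}^q$ and a partition $\mathcal{Z}$ of $\mathbb{S}^q$. Assume that $$5C_q(n+q^2)\|\mathcal{Z}\|\leq\eta$$ with $C_q:=2(3+3^{q/2}\pi)$. Then, for all $p\in[1,\infty]$ and every $P\in\Pi_n^q$, $$(1-\eta)\|P\|_{\mu_q,p}\leq\|P\|_{\mu_q(\Xi,\mathcal{Z}),p}\leq(1+\eta)\|P\|_{\mu_q,p}.$$
   Context: $\mathbb{S}^q=\{x\in\mathbb{R}^{q+1}:|x|_2=1\}$ is the unit sphere with geodesic distance $d(x,y)=\arccos(x\cdot y)$ and (unnormalized) surface measure $\mu_q$, so $\mu_q(\mathbb{S}^q)=2\pi^{(q+1)/2}/\Gamma(\frac{q+1}{2})$. $\Pi_n^q$ is the vector space of spherical harmonics of degree at most $n$, i.e. $\Pi_n^q=\bigoplus_{\ell=0}^n\mathcal{H}_\ell^q$, where $\mathcal{H}_\ell^q$ is the space of restrictions to $\mathbb{S}^q$ of (complex-valued) harmonic homogeneous polynomials of degree $\ell$ on $\mathbb{R}^{q+1}$. For a measure $\mu$ on $\mathbb{S}^q$ and $f:\mathbb{S}^q\to\mathbb{C}$, $\|f\|_{\mu,p}=(\int_{\mathbb{S}^q}|f|^p\,d\mu)^{1/p}$ for $1\leq p<\infty$, and $\|f\|_{\mu,\infty}$ is the $\mu$-essential supremum of $|f|$. A partition of $\mathbb{S}^q$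 is a finite family $\mathcal{Z}=\{Z_1,\dots,Z_N\}$ of measurable subsets (patches) of $\mathbb{S}^q$ whose interiors are pairwise disjoint and whose union is $\mathbb{S}^q$. The partition norm is $\|\mathcal{Z}\|=\max_{Z\in\mathcal{Z}}\max_{x,y\in Z}d(x,y)$. A finite set $\Xi\subseteq\mathbb{S}^q$ is compatible with $\mathcal{Z}$ (and $(\Xi,\mathcal{Z})$ is called a compatible pair) if there is precisely one element of $\Xi$ in the interior of every patch, and $\Xi\cap Z_k$ consists of just that one point for every $k\in\{1,\dots,N\}$. For $\xi\in\Xi$, $Z_\xi$ denotes the patch containing $\xi$. The discretized measure is $\mu_q(\Xi,\mathcal{Z})=\sum_{\xi\in\Xi}\mu_q(Z_\xi)\delta_\xi$ with $\delta_\xi$ the Dirac measure at $\xi$; thus $\|P\|_{\mu_q(\Xi,\mathcal{Z}),p}=\big(\sum_{\xi\in\Xi}\mu_q(Z_\xi)|P(\xi)|^p\big)^{1/p}$ for $1\leq p<\infty$ and $\|P\|_{\mu_q(\Xi,\mathcal{Z}),\infty}=\max_{\xi\in\Xi}|P(\xi)|$.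
   Formalization: Distinct patches are additionally required to overlap only in sets of surface measure zero; with only disjoint interiors the claim fails, since a nowhere dense set of positive measure can be added to several patches (n=0, P=1, p=1). *)

theory Defs
  imports "HOL-Probability.Probability"
begin

text \<open>
  Throughout, the index type \<open>'d\<close> has \<open>q + 1\<close> elements, so that \<open>sphere 0 1 :: (real ^ 'd) set\<close>
  is the unit sphere of dimension \<open>q\<close>.
\<close>

section \<open>Surface measure\<close>

text \<open>
  Polar coordinates: the surface measure of a Borel set \<open>A\<close> is \<open>q + 1\<close> times the volume of the cone
  \<open>{t x | 0 < t \<le> 1, x \<in> A}\<close>. The measure is completed (as \<^const>\<open>lebesgue\<close> is), so that
  Lebesgue measurable patches are allowed.
\<close>

definition sphere_measure :: "(real ^ 'd) measure" where
  "sphere_measure = completion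
     (distr (scale_measure (of_nat CARD('d)) (restrict_space lborel (cball 0 1 - {0})))
            (restrict_space borel (sphere 0 1)) (\<lambda>x. x /\<^sub>R norm x))"

lemma space_sphere_measure: "space (sphere_measure :: (real ^ 'd) measure) = sphere 0 1"
  by (simp add: sphere_measure_def space_restrict_space)

lemma radial_projection_measurable:
  "(\<lambda>x. x /\<^sub>R norm x) \<in> restrict_space lborel (cball 0 1 - {0 :: real ^ 'd})
     \<rightarrow>\<^sub>M restrict_space borel (sphere 0 1)"
proof (rule measurable_restrict_space2)
  show "(\<lambda>x. x /\<^sub>R norm x) \<in> borel_measurable (restrict_space lborel (cball 0 1 - {0 :: real ^ 'd}))"
    by (rule measurable_restrict_space1) measurable
qed (auto simp: space_restrict_space)

lemma emeasure_sphere_measure_borel: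
  fixes A :: "(real ^ 'd) set"
  assumes "A \<in> sets borel" "A \<subseteq> sphere 0 1"
  shows "emeasure sphere_measure A =
           of_nat CARD('d) * emeasure lborel {t *\<^sub>R x | t x. 0 < t \<and> t \<le> 1 \<and> x \<in> A}"
proof -
  let ?D = "cball 0 1 - {0 :: real ^ 'd}" and ?g = "\<lambda>x :: real ^ 'd. x /\<^sub>R norm x"
  let ?N = "scale_measure (of_nat CARD('d)) (restrict_space lborel ?D)"
  let ?B = "restrict_space borel (sphere 0 1 :: (real ^ 'd) set)"
  have A: "A \<in> sets ?B"
    using assms by (auto simp: sets_restrict_space_iff)
  have g: "?g \<in> ?N \<rightarrow>\<^sub>M ?B"
    using radial_projection_measurable by (simp cong: measurable_cong_sets)
  have cone: "?g -` A \<inter> ?D = {t *\<^sub>R x | t x. 0 < t \<and> t \<le> 1 \<and> x \<in> A}" (is "_ = ?C")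
  proof (intro set_eqI iffI)
    fix y assume y: "y \<in> ?g -` A \<inter> ?D"
    then have "y = norm y *\<^sub>R ?g y" "0 < norm y" "norm y \<le> 1" "?g y \<in> A"
      by auto
    then show "y \<in> ?C" by blast
  next
    fix y assume "y \<in> ?C"
    then obtain t x where tx: "y = t *\<^sub>R x" "0 < t" "t \<le> 1" "x \<in> A" by blast
    moreover have "norm x = 1" using tx assms(2) by auto
    ultimately show "y \<in> ?g -` A \<inter> ?D" by auto
  qed
  have "emeasure sphere_measure A = emeasure (distr ?N ?B ?g) A"
    unfolding sphere_measure_def using A by simp
  also have "\<dots> = emeasure ?N (?g -` A \<inter> space ?N)"
    using g A by (rule emeasure_distr)
  also have "space ?N = ?D"
    by (simp add: space_scale_measure space_restrict_space)
  also have "emeasure ?N (?g -` A \<inter> ?D) =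
      of_nat CARD('d) * emeasure (restrict_space lborel ?D) (?g -` A \<inter> ?D)"
    by simp
  also have "emeasure (restrict_space lborel ?D) (?g -` A \<inter> ?D) = emeasure lborel (?g -` A \<inter> ?D)"
    by (rule emeasure_restrict_space) auto
  finally show ?thesis by (simp only: cone)
qed

lemma emeasure_sphere_measure_total:
  "emeasure sphere_measure (sphere 0 1 :: (real ^ 'd) set) =
     ennreal (2 * pi powr (CARD('d) / 2) / Gamma (CARD('d) / 2))"
proof -
  let ?m = "real CARD('d)"
  have C: "{t *\<^sub>R x | t x. 0 < t \<and> t \<le> 1 \<and> x \<in> sphere 0 1} = cball 0 1 - {0 :: real ^ 'd}"
    (is "?C = _")
  proof (intro set_eqI iffI)
    fix y :: "real ^ 'd" assume "y \<in> cball 0 1 - {0}"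
    then have "y = norm y *\<^sub>R (y /\<^sub>R norm y)" "0 < norm y" "norm y \<le> 1"
      "y /\<^sub>R norm y \<in> sphere 0 1"
      by auto
    then show "y \<in> ?C" by blast
  qed auto
  have m: "?m > 0" by simp
  have "emeasure sphere_measure (sphere 0 1 :: (real ^ 'd) set) =
      of_nat CARD('d) * emeasure lborel (cball 0 1 - {0 :: real ^ 'd})"
    by (subst emeasure_sphere_measure_borel) (auto simp only: C closed_sphere borel_closed)
  also have "emeasure lborel (cball 0 1 - {0 :: real ^ 'd}) = emeasure lborel (cball (0 :: real ^ 'd) 1)"
    by (rule emeasure_Diff_null_set) auto
  also have "\<dots> = ennreal (unit_ball_vol ?m)"
    by (simp add: emeasure_cball)
  also have "of_nat CARD('d) * ennreal (unit_ball_vol ?m) = ennreal (?m * unit_ball_vol ?m)"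
    by (simp add: ennreal_mult ennreal_of_nat_eq_real_of_nat)
  also have "?m * unit_ball_vol ?m = 2 * pi powr (?m / 2) / Gamma (?m / 2)"
  proof -
    have "?m / 2 \<notin> \<int>\<^sub>\<le>\<^sub>0"
      using m nonpos_Ints_nonpos[of "?m / 2"] by linarith
    then have "Gamma (?m / 2 + 1) = ?m / 2 * Gamma (?m / 2)"
      by (rule Gamma_plus1)
    moreover have "Gamma (?m / 2) > 0"
      using m by (intro Gamma_real_pos) simp
    ultimately show ?thesis
      using m by (simp only: unit_ball_vol_def) simp
  qed
  finally show ?thesis .
qed

section \<open>Norms\<close>

text \<open>
  The \<open>L\<^sup>p\<close> norm for \<open>p \<in> [1,\<infinity>]\<close>. It is real-valued and therefore meaningful only for
  \<open>f\<close> in \<open>L\<^sup>p\<close>; below it is only applied to functions that are continuous on the sphere and to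
  finite measures.
\<close>

definition Lp_norm :: "'a measure \<Rightarrow> ereal \<Rightarrow> ('a \<Rightarrow> complex) \<Rightarrow> real" where
  "Lp_norm M p f =
     (if p = \<infinity> then real_of_ereal (esssup M (\<lambda>x. ereal (cmod (f x))))
      else (\<integral>x. cmod (f x) powr real_of_ereal p \<partial>M) powr (1 / real_of_ereal p))"

section \<open>Spherical harmonics\<close>

definition partial_deriv :: "'d \<Rightarrow> (real ^ 'd \<Rightarrow> complex) \<Rightarrow> real ^ 'd \<Rightarrow> complex" where
  "partial_deriv i f x = vector_derivative (\<lambda>t. f (x + t *\<^sub>R axis i 1)) (at 0)"

definition laplacian :: "(real ^ 'd \<Rightarrow> complex) \<Rightarrow> real ^ 'd \<Rightarrow> complex" where
  "laplacian f x = (\<Sum>i\<in>UNIV. partial_deriv i (partial_deriv i f) x)"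

definition homogeneous_polynomial :: "nat \<Rightarrow> (real ^ 'd \<Rightarrow> complex) \<Rightarrow> bool" where
  "homogeneous_polynomial l f \<longleftrightarrow>
     polynomial_function f \<and> (\<forall>t x. f (t *\<^sub>R x) = of_real t ^ l * f x)"

definition harmonic_polynomial :: "nat \<Rightarrow> (real ^ 'd \<Rightarrow> complex) \<Rightarrow> bool" where
  "harmonic_polynomial l f \<longleftrightarrow> homogeneous_polynomial l f \<and> (\<forall>x. laplacian f x = 0)"

text \<open>
  A function on the sphere is represented by a function on the ambient space whose values off the
  sphere are irrelevant.
\<close>

definition harmonics :: "nat \<Rightarrow> (real ^ 'd \<Rightarrow> complex) set" where
  "harmonics l = {Y. \<exists>f. harmonic_polynomial l f \<and> (\<forall>x\<in>sphere 0 1. Y x = f x)}"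

definition harmonics_upto :: "nat \<Rightarrow> (real ^ 'd \<Rightarrow> complex) set" where
  "harmonics_upto n =
     {P. \<exists>Y. (\<forall>l\<le>n. Y l \<in> harmonics l) \<and> P = (\<lambda>x. \<Sum>l\<le>n. Y l x)}"

section \<open>Partitions and compatible pairs\<close>

definition geodesic_dist :: "real ^ 'd \<Rightarrow> real ^ 'd \<Rightarrow> real" where
  "geodesic_dist x y = arccos (x \<bullet> y)"

text \<open>Interiors are taken in the topology of the sphere; ambient interiors would be empty.\<close>

definition sphere_interior :: "(real ^ 'd) set \<Rightarrow> (real ^ 'd) set" where
  "sphere_interior Z = top_of_set (sphere 0 1) interior_of Z"

text \<open>
  Besides having disjoint interiors, distinct patches of a partition overlap only in null sets.
  This is implicit in the notion of a partition and does not follow from the disjointness of the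
  interiors: a closed nowhere dense set of positive measure can be added to several patches without
  changing their interiors, and then the measures of the patches do not add up to the measure of
  the sphere.
\<close>

definition sphere_partition :: "(real ^ 'd) set set \<Rightarrow> bool" where
  "sphere_partition \<Z> \<longleftrightarrow>
     finite \<Z> \<and> \<Z> \<subseteq> sets sphere_measure \<and> \<Union>\<Z> = sphere 0 1 \<and>
     (\<forall>Z\<in>\<Z>. \<forall>Z'\<in>\<Z>. Z \<noteq> Z' \<longrightarrow>
        sphere_interior Z \<inter> sphere_interior Z' = {} \<and> emeasure sphere_measure (Z \<inter> Z') = 0)"

text \<open>Patches need not be closed, so the maximum in the partition norm is a supremum.\<close>

definition partition_norm :: "(real ^ 'd) set set \<Rightarrow> real" where
  "partition_norm \<Z> = (SUP (x, y) \<in> (\<Union>Z\<in>\<Z>. Z \<times> Z). geodesic_dist x y)"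

definition compatible_pair :: "(real ^ 'd) set \<Rightarrow> (real ^ 'd) set set \<Rightarrow> bool" where
  "compatible_pair \<Xi> \<Z> \<longleftrightarrow>
     finite \<Xi> \<and> \<Xi> \<subseteq> sphere 0 1 \<and> sphere_partition \<Z> \<and>
     (\<forall>Z\<in>\<Z>. \<exists>\<xi>. \<Xi> \<inter> sphere_interior Z = {\<xi>} \<and> \<Xi> \<inter> Z = {\<xi>})"

definition patch_of :: "(real ^ 'd) set set \<Rightarrow> real ^ 'd \<Rightarrow> (real ^ 'd) set" where
  "patch_of \<Z> \<xi> = (THE Z. Z \<in> \<Z> \<and> \<xi> \<in> Z)"

lemma ex1_patch:
  assumes "compatible_pair \<Xi> \<Z>" "\<xi> \<in> \<Xi>"
  shows "\<exists>!Z. Z \<in> \<Z> \<and> \<xi> \<in> Z"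
proof -
  have int: "\<xi> \<in> sphere_interior Z" if "Z \<in> \<Z>" "\<xi> \<in> Z" for Z
  proof -
    obtain \<zeta> where \<zeta>: "\<Xi> \<inter> sphere_interior Z = {\<zeta>}" "\<Xi> \<inter> Z = {\<zeta>}"
      using assms(1) \<open>Z \<in> \<Z>\<close> by (auto simp: compatible_pair_def)
    with assms(2) \<open>\<xi> \<in> Z\<close> show ?thesis by auto
  qed
  have part: "sphere_partition \<Z>" and sub: "\<Xi> \<subseteq> sphere 0 1"
    using assms(1) by (simp_all add: compatible_pair_def)
  have "\<Union>\<Z> = sphere 0 1"
    using part by (simp add: sphere_partition_def)
  then obtain Z where Z: "Z \<in> \<Z>" "\<xi> \<in> Z"
    using sub assms(2) by blast
  have "Z' = Z" if Z': "Z' \<in> \<Z>" "\<xi> \<in> Z'" for Z'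
  proof (rule ccontr)
    assume "Z' \<noteq> Z"
    then have "sphere_interior Z' \<inter> sphere_interior Z = {}"
      using part Z(1) Z'(1) by (simp add: sphere_partition_def)
    with int[OF Z] int[OF Z'] show False by blast
  qed
  with Z show ?thesis by blast
qed

definition discretized_measure :: "(real ^ 'd) set \<Rightarrow> (real ^ 'd) set set \<Rightarrow> (real ^ 'd) measure" where
  "discretized_measure \<Xi> \<Z> =
     distr (point_measure \<Xi> (\<lambda>\<xi>. emeasure sphere_measure (patch_of \<Z> \<xi>))) sphere_measure (\<lambda>x. x)"

lemma emeasure_discretized_measure:
  assumes "finite \<Xi>" "\<Xi> \<subseteq> sphere 0 1" "A \<in> sets sphere_measure"
  shows "emeasure (discretized_measure \<Xi> \<Z>) A =
           (\<Sum>\<xi>\<in>\<Xi>. emeasure sphere_measure (patch_of \<Z> \<xi>) * indicator A \<xi>)"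
proof -
  have "emeasure (discretized_measure \<Xi> \<Z>) A =
      (\<Sum>\<xi>\<in>A \<inter> \<Xi>. emeasure sphere_measure (patch_of \<Z> \<xi>))"
    unfolding discretized_measure_def using assms
    by (subst emeasure_distr)
       (auto simp: space_sphere_measure space_point_measure emeasure_point_measure_finite)
  then show ?thesis
    using assms(1)
    by (simp add: Int_commute[of A] sum.inter_restrict indicator_def of_bool_def if_distrib cong: if_cong)
qed

definition C_const :: "nat \<Rightarrow> real" where
  "C_const q = 2 * (3 + 3 powr (real q / 2) * pi)"

end

theory Submission
  imports Defs
begin

text \<open>
  If \<open>P\<close> is a spherical polynomial of degree at most \<open>n\<close> and \<open>R\<^sub>t\<close> a rotation by the angle \<open>t\<close> in a
  coordinate plane, then \<open>t \<mapsto> P (R\<^sub>t x)\<close> is a trigonometric polynomial of degree at most \<open>n\<close>, so by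
  Riesz' interpolation formula its derivative at \<open>0\<close> is a fixed combination of values
  \<open>P (R\<^sub>t x)\<close> with coefficients of total mass \<open>n\<close>. As the surface measure is invariant under rotations,
  each of the \<open>K = q (q + 1)\<close> derivatives \<open>D\<close> along coordinate planes satisfies Bernstein's
  inequality \<open>\<parallel>D P\<parallel>\<^sub>p \<le> n \<parallel>P\<parallel>\<^sub>p\<close> and preserves the space of polynomials.
  Taylor expansion along the great circle from \<open>x\<close> to the node of its patch bounds the difference of
  the two values of \<open>P\<close> by \<open>\<Sum>m\<ge>1. h\<^sup>m / m! * \<Sum> \<bar>D \<dots> D P (x)\<bar>\<close>, with \<open>h\<close> the partition norm and
  the inner sum over all words of length \<open>m\<close>. This majorant depends on \<open>x\<close> only, and its \<open>L\<^sup>p\<close> norm is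
  at most \<open>(exp (h K n) - 1) \<parallel>P\<parallel>\<^sub>p \<le> \<eta> \<parallel>P\<parallel>\<^sub>p\<close>.
\<close>

section \<open>Trigonometric polynomials and Riesz interpolation\<close>

text \<open>For finite \<open>p\<close>, a first-order estimate of the difference between a node and
  a point \<open>x\<close> of its patch would involve the maximum of a derivative over the patch,
  which Bernstein's inequality in \<open>L^p\<close> does not control. Expanding to arbitrary order
  trades this maximum for derivatives at the single point \<open>x\<close>. Only finite expansions
  occur: the remainder after order \<open>M\<close> is bounded by the sup norm of the polynomial,
  but with the factor \<open>y^(M+1) / (M+1)!\<close>, \<open>y = h K n\<close>, so it disappears as
  \<open>M\<close> grows. The direction of the great circle changes with \<open>x\<close>, whereas
  invariance of the measure concerns one fixed rotation at a time. Coordinate planes provide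
  finitely many fixed rotations whose generators span all directions, at the price of the factor
  \<open>K\<close>; as they do not commute, words replace multi-indices. The constant
  \<open>C_q\<close> is exponential in \<open>q\<close> and \<open>K\<close> only quadratic, so that
  \<open>2 K \<le> 2 (q+1)^2 \<le> 5 C_q\<close>. The assumption thus gives
  \<open>2 y \<le> \<eta>\<close>, and \<open>exp y - 1 \<le> 2 y\<close> for
  \<open>y \<le> 1/2\<close>. For \<open>p = \<infinity>\<close> the sup norm is the norm in
  question, and the expansion can stop at its remainder of first order.\<close>

definition trig_poly :: "nat \<Rightarrow> (real \<Rightarrow> complex) \<Rightarrow> bool" where
  "trig_poly n g \<longleftrightarrow> (\<exists>c. \<forall>t. g t = (\<Sum>k\<in>{-int n..int n}. c k * cis (of_int k * t)))"

lemma trig_poly_span: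
  assumes "finite K" "K \<subseteq> {-int n..int n}" "\<And>t. g t = (\<Sum>k\<in>K. c k * cis (of_int k * t))"
  shows "trig_poly n g"
  unfolding trig_poly_def
proof (intro exI allI)
  fix t
  show "g t = (\<Sum>k\<in>{-int n..int n}. (if k \<in> K then c k else 0) * cis (of_int k * t))"
    unfolding assms(3) using assms(2) by (intro sum.mono_neutral_cong_left) auto
qed

lemma trig_poly_const: "trig_poly n (\<lambda>t. z)"
  by (rule trig_poly_span[of "{0}" _ _ "\<lambda>_. z"]) auto

lemma trig_poly_cis: "\<bar>k\<bar> \<le> int n \<Longrightarrow> trig_poly n (\<lambda>t. cis (of_int k * t))"
  by (rule trig_poly_span[of "{k}" _ _ "\<lambda>_. 1"]) auto

lemma trig_poly_add:
  assumes "trig_poly n f" "trig_poly n g"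
  shows "trig_poly n (\<lambda>t. f t + g t)"
proof -
  obtain c d where "\<And>t. f t = (\<Sum>k\<in>{-int n..int n}. c k * cis (of_int k * t))"
    "\<And>t. g t = (\<Sum>k\<in>{-int n..int n}. d k * cis (of_int k * t))"
    using assms unfolding trig_poly_def by blast
  then show ?thesis
    unfolding trig_poly_def
    by (intro exI[of _ "\<lambda>k. c k + d k"]) (simp add: sum.distrib distrib_right)
qed

lemma trig_poly_cmult:
  assumes "trig_poly n f"
  shows "trig_poly n (\<lambda>t. z * f t)"
proof -
  obtain c where "\<And>t. f t = (\<Sum>k\<in>{-int n..int n}. c k * cis (of_int k * t))"
    using assms unfolding trig_poly_def by blast
  then show ?thesis
    unfolding trig_poly_def
    by (intro exI[of _ "\<lambda>k. z * c k"]) (simp add: sum_distrib_left mult.assoc)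
qed

lemma trig_poly_sum:
  assumes "\<And>i. i \<in> I \<Longrightarrow> trig_poly n (f i)"
  shows "trig_poly n (\<lambda>t. \<Sum>i\<in>I. f i t)"
  using assms
  by (induction I rule: infinite_finite_induct)
     (auto intro: trig_poly_const trig_poly_add)

lemma trig_poly_mono:
  assumes "trig_poly m f" "m \<le> n"
  shows "trig_poly n f"
proof -
  obtain c where "\<And>t. f t = (\<Sum>k\<in>{-int m..int m}. c k * cis (of_int k * t))"
    using assms unfolding trig_poly_def by blast
  then show ?thesis
    using assms(2) by (intro trig_poly_span[of "{-int m..int m}"]) auto
qed

lemma trig_poly_mult:
  assumes "trig_poly m f" "trig_poly n g"
  shows "trig_poly (m + n) (\<lambda>t. f t * g t)"
proof -
  obtain c d where c: "\<And>t. f t = (\<Sum>k\<in>{-int m..int m}. c k * cis (of_int k * t))"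
    and d: "\<And>t. g t = (\<Sum>k\<in>{-int n..int n}. d k * cis (of_int k * t))"
    using assms unfolding trig_poly_def by blast
  have "(\<lambda>t. f t * g t) = (\<lambda>t. \<Sum>j\<in>{-int m..int m}. \<Sum>k\<in>{-int n..int n}.
      c j * d k * cis (of_int (j + k) * t))"
    by (simp add: c d sum_product cis_mult[symmetric] distrib_right mult.assoc mult.left_commute)
  moreover have "trig_poly (m + n) (\<lambda>t. \<Sum>j\<in>{-int m..int m}. \<Sum>k\<in>{-int n..int n}.
      c j * d k * cis (of_int (j + k) * t))"
    by (intro trig_poly_sum trig_poly_cmult trig_poly_cis) auto
  ultimately show ?thesis by simp
qed

lemma trig_poly_cos: "trig_poly 1 (\<lambda>t. complex_of_real (cos t))"
proof -
  have "(\<lambda>t. complex_of_real (cos t)) = (\<lambda>t. 1/2 * cis (of_int 1 * t) + 1/2 * cis (of_int (-1) * t))"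
    by (auto simp: complex_eq_iff)
  moreover have "trig_poly 1 (\<lambda>t. 1/2 * cis (of_int 1 * t) + 1/2 * cis (of_int (-1) * t))"
    by (intro trig_poly_add trig_poly_cmult trig_poly_cis) auto
  ultimately show ?thesis by simp
qed

lemma trig_poly_sin: "trig_poly 1 (\<lambda>t. complex_of_real (sin t))"
proof -
  have "(\<lambda>t. complex_of_real (sin t)) = (\<lambda>t. -\<i>/2 * cis (of_int 1 * t) + \<i>/2 * cis (of_int (-1) * t))"
    by (auto simp: complex_eq_iff)
  moreover have "trig_poly 1 (\<lambda>t. -\<i>/2 * cis (of_int 1 * t) + \<i>/2 * cis (of_int (-1) * t))"
    by (intro trig_poly_add trig_poly_cmult trig_poly_cis) auto
  ultimately show ?thesis by simp
qed

section \<open>Riesz' interpolation formula for the derivative at 0\<close>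

definition riesz_node :: "nat \<Rightarrow> nat \<Rightarrow> real" where
  "riesz_node n k = 2 * pi * real k / real (4 * n)"

text \<open>A Fejer kernel sampled at the nodes. For \<open>n > 0\<close> and even \<open>k\<close>
  in \<open>1..<4 * n\<close> the inner sum runs over full periods of a root of unity and vanishes,
  so that besides node 0 only the \<open>2 n\<close> odd multiples of \<open>pi / (2 n)\<close>
  carry weight: the nodes of the classical formula.\<close>

definition fejer_weight :: "nat \<Rightarrow> nat \<Rightarrow> real" where
  "fejer_weight n k = (cmod (\<Sum>a<2 * n. cis (real a * riesz_node n k)))\<^sup>2 / real (4 * n)"

text \<open>The modulation by frequency \<open>n\<close> moves the linear flank of the triangular
  wave over the frequencies \<open>-n..n\<close>. Summing over all nodes turns frequency
  \<open>j\<close> into \<open>\<i> * (n + j)\<close>; node 0 accounts for \<open>\<i> * n\<close>,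
  and leaving it out gives the symbol \<open>\<i> * j\<close> of the derivative.\<close>

definition riesz_coeff :: "nat \<Rightarrow> nat \<Rightarrow> complex" where
  "riesz_coeff n k = \<i> * of_real (fejer_weight n k) * cis (- (real n * riesz_node n k))"

lemma sum_cis_riesz_node:
  assumes "n > 0"
  shows "(\<Sum>k<4 * n. cis (of_int m * riesz_node n k)) = (if int (4 * n) dvd m then of_nat (4 * n) else 0)"
proof -
  let ?N = "4 * n"
  define z where "z = cis (2 * pi * of_int m / real ?N)"
  have pow: "cis (of_int m * riesz_node n k) = z ^ k" for k
  proof -
    have "of_int m * riesz_node n k = real k * (2 * pi * of_int m / real ?N)"
      by (simp add: riesz_node_def)
    then show ?thesis
      by (simp only: z_def Complex.DeMoivre)
  qed
  have zN: "z ^ ?N = 1"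
    unfolding z_def Complex.DeMoivre using assms cis_multiple_2pi[of "of_int m"] by (simp add: mult.assoc)
  show ?thesis
  proof (cases "int ?N dvd m")
    case True
    then obtain j where "m = int ?N * j" by blast
    then have "z = 1"
      unfolding z_def using assms cis_multiple_2pi[of "of_int j"] by (simp add: mult.assoc)
    then show ?thesis using True by (simp add: pow)
  next
    case False
    have "z \<noteq> 1"
    proof
      assume "z = 1"
      then have "cos (2 * pi * of_int m / real ?N) = 1"
        unfolding z_def by (simp add: complex_eq_iff)
      then obtain j :: int where "2 * pi * of_int m / real ?N = of_int j * 2 * pi"
        by (auto simp: cos_one_2pi_int)
      then have "real_of_int m = real_of_int (int ?N * j)"
        using assms by (simp add: field_simps)
      then have "m = int ?N * j" by linarith
      then show False using False by simp
    qed
    then have "(\<Sum>k<?N. z ^ k) = 0"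
      using zN by (simp add: sum_gp_strict)
    then show ?thesis using False by (simp add: pow)
  qed
qed

text \<open>The weights are the discrete Fourier transform of a triangular wave of period \<open>4 n\<close>, realised
  as the autocorrelation of a box of length \<open>2 n\<close>; this is what makes them nonnegative.\<close>

lemma sum_fejer_weight_cis:
  assumes "m \<le> 2 * n"
  shows "(\<Sum>k<4 * n. of_real (fejer_weight n k) * cis (- (real m * riesz_node n k)))
    = complex_of_real (real (2 * n - m))"
proof (cases "n = 0")
  case True
  then show ?thesis by simp
next
  case False
  then have n: "n > 0" by simp
  let ?N = "4 * n" and ?L = "2 * n"
  let ?x = "riesz_node n"
  have w: "of_real (fejer_weight n k) * cis (- (real m * ?x k)) =
      (\<Sum>a<?L. \<Sum>b<?L. cis (of_int (int a - int b - int m) * ?x k)) / of_nat ?N" for k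
  proof -
    have "complex_of_real ((cmod (\<Sum>a<?L. cis (real a * ?x k)))\<^sup>2) =
        (\<Sum>a<?L. cis (real a * ?x k)) * cnj (\<Sum>a<?L. cis (real a * ?x k))"
      by (rule complex_norm_square)
    also have "\<dots> = (\<Sum>a<?L. \<Sum>b<?L. cis (of_int (int a - int b) * ?x k))"
      by (simp add: sum_product cis_cnj cis_mult left_diff_distrib)
    finally show ?thesis
      by (simp add: fejer_weight_def sum_distrib_right sum_distrib_left sum_divide_distrib cis_mult
          left_diff_distrib algebra_simps)
  qed
  have dv: "int ?N dvd int a - int b - int m \<longleftrightarrow> a = b + m" if "a < ?L" "b < ?L" for a b
  proof
    assume "int ?N dvd int a - int b - int m"
    then obtain j where j: "int a - int b - int m = int ?N * j" by blast
    \<comment> \<open>No aliasing: a box of length \<open>2 n\<close> and a shift by at most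
      \<open>2 n\<close> keep the frequency strictly between \<open>-4 n\<close> and
      \<open>4 n\<close>, so 0 is the only multiple of \<open>4 n\<close> it can hit.\<close>
    have "- int ?N < int a - int b - int m" "int a - int b - int m < int ?N"
      using that assms by auto
    then have "int ?N * (-1) < int ?N * j" "int ?N * j < int ?N * 1"
      unfolding j by auto
    then have "-1 < j" "j < 1"
      using n by (simp_all only: mult_less_cancel_left_pos of_nat_0_less_iff zero_less_mult_iff zero_less_numeral)
    then have "j = 0" by simp
    then show "a = b + m" using j by simp
  qed auto
  have "(\<Sum>k<?N. of_real (fejer_weight n k) * cis (- (real m * ?x k))) =
      (\<Sum>a<?L. \<Sum>b<?L. \<Sum>k<?N. cis (of_int (int a - int b - int m) * ?x k)) / of_nat ?N"
    unfolding w sum_divide_distrib[symmetric]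
    by (subst sum.swap, subst sum.swap) (rule refl)
  also have "\<dots> = (\<Sum>a<?L. \<Sum>b<?L. if a = b + m then of_nat ?N else 0) / of_nat ?N"
    unfolding sum_cis_riesz_node[OF n]
    by (intro arg_cong2[where f = "(/)"] sum.cong refl if_cong) (simp only: dv lessThan_iff)
  also have "(\<Sum>a<?L. \<Sum>b<?L. if a = b + m then of_nat ?N else 0) =
      (\<Sum>b<?L. if b + m < ?L then of_nat ?N else (0::complex))"
    by (subst sum.swap) (simp add: sum.delta)
  also have "\<dots> = (\<Sum>b\<in>{..<?L - m}. of_nat ?N)"
    by (intro sum.mono_neutral_cong_right) auto
  also have "\<dots> / of_nat ?N = complex_of_real (real (?L - m))"
    using n by simp
  finally show ?thesis .
qed

lemma fejer_weight_nonneg: "fejer_weight n k \<ge> 0"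
  by (simp add: fejer_weight_def)

lemma fejer_weight_0: "fejer_weight n 0 = real n"
  by (simp add: fejer_weight_def riesz_node_def power2_eq_square)

text \<open>As the weights are nonnegative, their total mass is the triangular wave at frequency 0,
  namely \<open>2 n\<close>, and node 0 takes away \<open>n\<close>. This is the constant in
  Bernstein's inequality.\<close>

lemma sum_norm_riesz_coeff: "(\<Sum>k = 1..<4 * n. cmod (riesz_coeff n k)) = real n"
proof (cases "n = 0")
  case False
  have "complex_of_real (\<Sum>k<4 * n. fejer_weight n k) = complex_of_real (real (2 * n))"
    using sum_fejer_weight_cis[of 0 n] by simp
  then have "(\<Sum>k<4 * n. fejer_weight n k) = 2 * real n"
    by (simp only: of_real_eq_iff of_nat_mult of_nat_numeral)
  moreover have "{..<4 * n} = insert 0 {1..<4 * n}"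
    using False by auto
  ultimately have "(\<Sum>k = 1..<4 * n. fejer_weight n k) = real n"
    by (simp add: fejer_weight_0)
  then show ?thesis
    by (simp add: riesz_coeff_def norm_mult fejer_weight_nonneg)
qed simp

lemma riesz_cis:
  assumes "\<bar>j\<bar> \<le> int n"
  shows "(\<Sum>k = 1..<4 * n. riesz_coeff n k * cis (of_int j * riesz_node n k)) = \<i> * of_int j"
proof (cases "n = 0")
  case True
  then show ?thesis using assms by simp
next
  case False
  define m where "m = nat (int n - j)"
  have m: "m \<le> 2 * n" "real m = real n - of_int j" "real (2 * n - m) = real n + of_int j"
    using assms by (auto simp: m_def)
  have "(\<Sum>k<4 * n. riesz_coeff n k * cis (of_int j * riesz_node n k)) =
      \<i> * (\<Sum>k<4 * n. of_real (fejer_weight n k) * cis (- (real m * riesz_node n k)))"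
    unfolding m(2) sum_distrib_left
    by (intro sum.cong) (auto simp: riesz_coeff_def cis_mult algebra_simps)
  also have "\<dots> = \<i> * (of_nat n + of_int j)"
    unfolding sum_fejer_weight_cis[OF m(1)] m(3) by simp
  finally have "(\<Sum>k<4 * n. riesz_coeff n k * cis (of_int j * riesz_node n k)) = \<i> * (of_nat n + of_int j)" .
  moreover have "{..<4 * n} = insert 0 {1..<4 * n}"
    using False by auto
  ultimately show ?thesis
    by (simp add: riesz_coeff_def fejer_weight_0 riesz_node_def algebra_simps)
qed

text \<open>Both sides are linear in \<open>g\<close>, so it suffices to check each exponential,
  which is \<open>riesz_cis\<close>.\<close>

lemma riesz_interpolation:
  assumes "trig_poly n g"
  shows "(g has_vector_derivative (\<Sum>k = 1..<4 * n. riesz_coeff n k * g (riesz_node n k))) (at 0)"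
proof -
  obtain c where c: "\<And>t. g t = (\<Sum>j\<in>{-int n..int n}. c j * cis (of_int j * t))"
    using assms unfolding trig_poly_def by blast
  have "((\<lambda>t. \<Sum>j\<in>{-int n..int n}. c j * cis (of_int j * t)) has_vector_derivative
      (\<Sum>j\<in>{-int n..int n}. c j * (\<i> * of_int j))) (at 0)"
  proof (intro has_vector_derivative_sum has_vector_derivative_mult_right)
    fix j :: int
    show "((\<lambda>t. cis (of_int j * t)) has_vector_derivative \<i> * of_int j) (at 0)"
      unfolding has_vector_derivative_def
      by (rule derivative_eq_intros refl)+ (auto simp: scaleR_conv_of_real algebra_simps)
  qed
  also have "(\<lambda>t. \<Sum>j\<in>{-int n..int n}. c j * cis (of_int j * t)) = g"
    using c by auto
  also have "(\<Sum>j\<in>{-int n..int n}. c j * (\<i> * of_int j)) =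
      (\<Sum>j\<in>{-int n..int n}. c j * (\<Sum>k = 1..<4 * n. riesz_coeff n k * cis (of_int j * riesz_node n k)))"
    by (intro sum.cong refl arg_cong2[where f = "(*)"] riesz_cis[symmetric]) (simp add: abs_le_iff)
  also have "\<dots> = (\<Sum>k = 1..<4 * n. riesz_coeff n k * g (riesz_node n k))"
    unfolding c sum_distrib_left by (subst sum.swap) (simp add: mult.left_commute)
  finally show ?thesis .
qed

section \<open>Derivatives along coordinate planes\<close>

text \<open>Admitting every ellipse, not only circles on the sphere, makes the class stable under
  all linear substitutions, in particular rotations. The centre \<open>z\<close> is the component of
  a point that a plane rotation fixes.\<close>

definition circle_trig :: "nat \<Rightarrow> (real ^ 'd \<Rightarrow> complex) \<Rightarrow> bool" where
  "circle_trig n f \<longleftrightarrow> (\<forall>x. f differentiable (at x)) \<and>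
     (\<forall>x y z. trig_poly n (\<lambda>t. f (z + cos t *\<^sub>R x + sin t *\<^sub>R y)))"

lemma circle_trig_continuous_on: "circle_trig n f \<Longrightarrow> continuous_on S f"
  unfolding circle_trig_def
  by (meson continuous_at_imp_continuous_on differentiable_imp_continuous_within)

lemma circle_trigD:
  "circle_trig n f \<Longrightarrow> trig_poly n (\<lambda>t. f (z + cos t *\<^sub>R x + sin t *\<^sub>R y))"
  by (simp add: circle_trig_def)

lemma circle_trig_mono: "circle_trig m f \<Longrightarrow> m \<le> n \<Longrightarrow> circle_trig n f"
  unfolding circle_trig_def by (blast intro: trig_poly_mono)

lemma circle_trig_cmult: "circle_trig n f \<Longrightarrow> circle_trig n (\<lambda>x. z * f x)"
  unfolding circle_trig_def by (auto intro!: trig_poly_cmult differentiable_mult)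

lemma circle_trig_sum:
  "finite I \<Longrightarrow> (\<And>i. i \<in> I \<Longrightarrow> circle_trig n (f i)) \<Longrightarrow> circle_trig n (\<lambda>x. \<Sum>i\<in>I. f i x)"
  unfolding circle_trig_def by (auto intro!: trig_poly_sum differentiable_sum)

lemma circle_trig_linear:
  fixes f :: "real ^ 'd \<Rightarrow> complex" and T :: "real ^ 'd \<Rightarrow> real ^ 'd"
  assumes "circle_trig n f" "linear T"
  shows "circle_trig n (\<lambda>x. f (T x))"
  unfolding circle_trig_def
proof (intro conjI allI)
  fix x y z :: "real ^ 'd"
  have "T differentiable (at x)"
    using assms(2) linear_imp_differentiable by blast
  moreover have "f differentiable (at (T x))"
    using assms(1) unfolding circle_trig_def by blast
  ultimately show "(\<lambda>x. f (T x)) differentiable (at x)"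
    using differentiable_chain_at[of T x f] by (simp add: o_def)
  show "trig_poly n (\<lambda>t. f (T (z + cos t *\<^sub>R x + sin t *\<^sub>R y)))"
    using assms(1) unfolding circle_trig_def
    by (simp add: linear_add[OF assms(2)] linear_scale[OF assms(2)])
qed

section \<open>Rotations in coordinate planes and their generators\<close>

definition coord_planes :: "('d \<times> 'd) set" where
  "coord_planes = {r. fst r \<noteq> snd r}"

definition plane_proj :: "'d \<times> 'd \<Rightarrow> real ^ 'd \<Rightarrow> real ^ 'd" where
  "plane_proj r y = (y $ fst r) *\<^sub>R axis (fst r) 1 + (y $ snd r) *\<^sub>R axis (snd r) 1"

definition plane_gen :: "'d \<times> 'd \<Rightarrow> real ^ 'd \<Rightarrow> real ^ 'd" where
  "plane_gen r y = (y $ snd r) *\<^sub>R axis (fst r) 1 - (y $ fst r) *\<^sub>R axis (snd r) 1"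

definition plane_rot :: "'d \<times> 'd \<Rightarrow> real \<Rightarrow> real ^ 'd \<Rightarrow> real ^ 'd" where
  "plane_rot r t y = (y - plane_proj r y) + cos t *\<^sub>R plane_proj r y + sin t *\<^sub>R plane_gen r y"

lemma finite_coord_planes [simp]: "finite (coord_planes :: ('d::finite \<times> 'd) set)"
  by (rule finite_subset[OF subset_UNIV]) simp

lemma linear_plane_rot: "linear (plane_rot r t)"
  unfolding plane_rot_def plane_proj_def plane_gen_def
  by (rule linearI) (simp_all add: algebra_simps scaleR_add_left)

lemma orthogonal_transformation_plane_rot:
  assumes "r \<in> coord_planes"
  shows "orthogonal_transformation (plane_rot r t :: real ^ 'd \<Rightarrow> _)"
  unfolding orthogonal_transformation
proof (intro conjI allI linear_plane_rot)
  fix y :: "real ^ 'd"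
  let ?p = "plane_proj r y" and ?g = "plane_gen r y"
  define a where "a = (y $ fst r)\<^sup>2 + (y $ snd r)\<^sup>2"
  have ne: "fst r \<noteq> snd r" "snd r \<noteq> fst r"
    using assms by (auto simp: coord_planes_def)
  then have ax: "axis (fst r) (1::real) $ snd r = 0" "axis (snd r) (1::real) $ fst r = 0"
    by (simp_all add: axis_def)
  have ip: "y \<bullet> ?p = a" "?p \<bullet> ?p = a" "y \<bullet> ?g = 0" "?p \<bullet> ?g = 0" "?g \<bullet> ?g = a"
    using ne by (simp_all add: plane_proj_def plane_gen_def a_def inner_axis_axis inner_axis
        inner_axis' inner_add_left inner_add_right inner_diff_left inner_diff_right power2_eq_square ax)
  have "plane_rot r t y \<bullet> plane_rot r t y = y \<bullet> y - a + a * (cos t * cos t) + a * (sin t * sin t)"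
    unfolding plane_rot_def
    by (simp add: inner_add_left inner_add_right inner_diff_left inner_diff_right ip
        inner_commute[of ?p y] inner_commute[of ?g y] inner_commute[of ?g ?p] algebra_simps)
  also have "\<dots> = y \<bullet> y - a + a * ((cos t)\<^sup>2 + (sin t)\<^sup>2)"
    by (simp only: power2_eq_square distrib_left)
  also have "\<dots> = y \<bullet> y"
    by (simp add: sin_cos_squared_add2)
  finally have "plane_rot r t y \<bullet> plane_rot r t y = y \<bullet> y" .
  then show "norm (plane_rot r t y) = norm y"
    by (simp add: norm_eq_sqrt_inner)
qed

lemma norm_plane_rot: "r \<in> coord_planes \<Longrightarrow> norm (plane_rot r t y) = norm y"
  using orthogonal_transformation_plane_rot orthogonal_transformation_norm by blast

text \<open>The derivative along the rotation is defined by Riesz' formula instead of a limit. As a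
  finite combination of rotated copies of \<open>f\<close> it stays in the class
  \<open>circle_trig n\<close>, and its norms can be read off from the coefficients.\<close>

definition plane_deriv :: "nat \<Rightarrow> 'd \<times> 'd \<Rightarrow> (real ^ 'd \<Rightarrow> complex) \<Rightarrow> real ^ 'd \<Rightarrow> complex" where
  "plane_deriv n r f y = (\<Sum>k = 1..<4 * n. riesz_coeff n k * f (plane_rot r (riesz_node n k) y))"

lemma circle_trig_plane_deriv: "circle_trig n f \<Longrightarrow> circle_trig n (plane_deriv n r f)"
  unfolding plane_deriv_def[abs_def]
  by (rule circle_trig_sum, simp, rule circle_trig_cmult, rule circle_trig_linear[OF _ linear_plane_rot])

lemma has_vector_derivative_compose:
  assumes "(g has_vector_derivative v) (at t)" "(f has_derivative f') (at (g t))"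
  shows "((\<lambda>t. f (g t)) has_vector_derivative f' v) (at t)"
proof -
  interpret f': bounded_linear f'
    using assms(2) by (rule has_derivative_bounded_linear)
  show ?thesis
    using has_derivative_compose[OF assms(1)[unfolded has_vector_derivative_def] assms(2)]
    by (simp add: has_vector_derivative_def f'.scaleR)
qed

text \<open>Two evaluations of the derivative of \<open>t \<mapsto> f (plane_rot r t y)\<close> at
  0: by Riesz' formula and by the chain rule.\<close>

lemma plane_deriv_eq_derivative:
  assumes "circle_trig n f" "(f has_derivative f') (at y)"
  shows "f' (plane_gen r y) = plane_deriv n r f y"
proof (rule vector_derivative_unique_at)
  have "trig_poly n (\<lambda>t. f (plane_rot r t y))"
    unfolding plane_rot_def by (rule circle_trigD[OF assms(1)])
  then show "((\<lambda>t. f (plane_rot r t y)) has_vector_derivative plane_deriv n r f y) (at 0)"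
    unfolding plane_deriv_def by (rule riesz_interpolation)
  have "((\<lambda>t. plane_rot r t y) has_vector_derivative plane_gen r y) (at 0)"
    unfolding plane_rot_def has_vector_derivative_def
    by (rule derivative_eq_intros refl)+ auto
  moreover have "(f has_derivative f') (at (plane_rot r 0 y))"
    using assms(2) by (simp add: plane_rot_def)
  ultimately show "((\<lambda>t. f (plane_rot r t y)) has_vector_derivative f' (plane_gen r y)) (at 0)"
    by (rule has_vector_derivative_compose)
qed

text \<open>\<open>plane_gen (i, j)\<close> is the skew matrix with entries 1 at
  \<open>(i, j)\<close> and -1 at \<open>(j, i)\<close>, and the right side is the skew map
  \<open>e x^T - x e^T\<close>. Using ordered pairs, each plane with both orientations, lets the
  coefficient be the plain product of coordinates; diagonal pairs have generator 0.\<close>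

lemma sum_plane_gen:
  fixes e x y :: "real ^ 'd"
  shows "(\<Sum>r\<in>coord_planes. (e $ fst r * x $ snd r) *\<^sub>R plane_gen r y) = (x \<bullet> y) *\<^sub>R e - (e \<bullet> y) *\<^sub>R x"
proof -
  have "(\<Sum>r\<in>coord_planes. (e $ fst r * x $ snd r) *\<^sub>R plane_gen r y) =
      (\<Sum>r\<in>UNIV. (e $ fst r * x $ snd r) *\<^sub>R plane_gen r y)"
    by (rule sum.mono_neutral_left) (auto simp: coord_planes_def plane_gen_def)
  also have "\<dots> = (\<Sum>i\<in>UNIV. \<Sum>j\<in>UNIV. (e $ i * x $ j) *\<^sub>R plane_gen (i, j) y)"
    unfolding UNIV_Times_UNIV[symmetric] by (subst sum.cartesian_product) (simp add: case_prod_beta)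
  also have "\<dots> = (x \<bullet> y) *\<^sub>R e - (e \<bullet> y) *\<^sub>R x"
  proof (rule vec_eq_iff[THEN iffD2], rule allI)
    fix m
    have "(\<Sum>i\<in>UNIV. \<Sum>j\<in>UNIV. (e $ i * x $ j) *\<^sub>R plane_gen (i, j) y) $ m =
        (\<Sum>i\<in>UNIV. \<Sum>j\<in>UNIV. (e $ i * x $ j) * (y $ j * axis i 1 $ m)) -
        (\<Sum>i\<in>UNIV. \<Sum>j\<in>UNIV. (e $ i * x $ j) * (y $ i * axis j 1 $ m))"
      by (simp add: plane_gen_def right_diff_distrib sum_subtractf)
    also have "(\<Sum>i\<in>UNIV. \<Sum>j\<in>UNIV. (e $ i * x $ j) * (y $ j * axis i 1 $ m)) =
        (\<Sum>j\<in>UNIV. \<Sum>i\<in>UNIV. if i = m then e $ i * x $ j * y $ j else 0)"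
      by (subst sum.swap) (intro sum.cong refl, auto simp: axis_def)
    also have "\<dots> = e $ m * (x \<bullet> y)"
      by (simp add: inner_vec_def sum_distrib_left mult.assoc)
    also have "(\<Sum>i\<in>UNIV. \<Sum>j\<in>UNIV. (e $ i * x $ j) * (y $ i * axis j 1 $ m)) =
        (\<Sum>i\<in>UNIV. \<Sum>j\<in>UNIV. if j = m then e $ i * x $ j * y $ i else 0)"
      by (intro sum.cong refl) (auto simp: axis_def)
    also have "\<dots> = x $ m * (e \<bullet> y)"
      by (simp add: inner_vec_def sum_distrib_left mult_ac)
    finally show "(\<Sum>i\<in>UNIV. \<Sum>j\<in>UNIV. (e $ i * x $ j) *\<^sub>R plane_gen (i, j) y) $ m =
        ((x \<bullet> y) *\<^sub>R e - (e \<bullet> y) *\<^sub>R x) $ m"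
      by (simp add: mult.commute)
  qed
  finally show ?thesis .
qed

text \<open>The recursion peels off the derivative applied to \<open>f\<close> first. This suits the
  inductions below, in which the hypothesis is used for \<open>plane_deriv n r f\<close> in place of
  \<open>f\<close>.\<close>

primrec deriv_sum :: "nat \<Rightarrow> nat \<Rightarrow> (real ^ 'd \<Rightarrow> complex) \<Rightarrow> real ^ 'd \<Rightarrow> real" where
  "deriv_sum n 0 f x = cmod (f x)"
| "deriv_sum n (Suc m) f x = (\<Sum>r\<in>coord_planes. deriv_sum n m (plane_deriv n r f) x)"

lemma deriv_sum_nonneg: "deriv_sum n m f x \<ge> 0"
  by (induction m arbitrary: f) (auto intro: sum_nonneg)

lemma continuous_on_deriv_sum: "circle_trig n f \<Longrightarrow> continuous_on S (deriv_sum n m f)"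
proof (induction m arbitrary: f)
  case 0
  then show ?case
    using continuous_on_norm[OF circle_trig_continuous_on] by (simp add: deriv_sum.simps(1)[abs_def])
next
  case (Suc m)
  have "continuous_on S (deriv_sum n m (plane_deriv n r f))" for r
    using Suc.prems by (intro Suc.IH circle_trig_plane_deriv)
  then have "continuous_on S (\<lambda>x. \<Sum>r\<in>coord_planes. deriv_sum n m (plane_deriv n r f) x)"
    by (intro continuous_on_sum)
  then show ?case
    by (simp only: deriv_sum.simps(2)[abs_def])
qed

text \<open>Bernstein's inequality for the sup norm; it serves the Taylor remainder.\<close>

lemma plane_deriv_bound:
  assumes "r \<in> coord_planes" "\<And>y. y \<in> sphere 0 1 \<Longrightarrow> cmod (f y) \<le> C" "y \<in> sphere 0 1"
  shows "cmod (plane_deriv n r f y) \<le> real n * C"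
proof -
  have "cmod (plane_deriv n r f y) \<le> (\<Sum>k = 1..<4 * n. cmod (riesz_coeff n k) * C)"
    unfolding plane_deriv_def
  proof (rule sum_norm_le)
    fix k
    have "plane_rot r (riesz_node n k) y \<in> sphere 0 1"
      using assms(1,3) by (simp add: norm_plane_rot)
    then show "cmod (riesz_coeff n k * f (plane_rot r (riesz_node n k) y)) \<le> cmod (riesz_coeff n k) * C"
      using assms(2) by (simp add: norm_mult mult_left_mono)
  qed
  also have "\<dots> = real n * C"
    by (simp only: sum_distrib_right[symmetric] sum_norm_riesz_coeff)
  finally show ?thesis .
qed

text \<open>The velocity of the great circle is the infinitesimal rotation in the plane of
  \<open>x\<close> and \<open>e\<close>, evaluated at the moving point. Hence the coefficients in
  the coordinate generators do not depend on \<open>t\<close>, and only the point at which the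
  derivatives are taken moves.\<close>

lemma has_vector_derivative_circle:
  fixes x e :: "real ^ 'd"
  assumes f: "circle_trig n f" and xe: "norm x = 1" "norm e = 1" "x \<bullet> e = 0"
  shows "((\<lambda>t. f (cos t *\<^sub>R x + sin t *\<^sub>R e)) has_vector_derivative
    (\<Sum>r\<in>coord_planes. of_real (e $ fst r * x $ snd r) * plane_deriv n r f (cos t *\<^sub>R x + sin t *\<^sub>R e))) (at t)"
proof -
  let ?y = "cos t *\<^sub>R x + sin t *\<^sub>R e"
  obtain f' where f': "(f has_derivative f') (at ?y)"
    using f unfolding circle_trig_def differentiable_def by blast
  then interpret f': bounded_linear f'
    by (rule has_derivative_bounded_linear)
  have sq: "x \<bullet> x = 1" "e \<bullet> e = 1" "e \<bullet> x = 0"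
    using xe by (simp_all add: dot_square_norm inner_commute)
  have "cos t *\<^sub>R e - sin t *\<^sub>R x = (x \<bullet> ?y) *\<^sub>R e - (e \<bullet> ?y) *\<^sub>R x"
    by (simp add: inner_add_right sq xe)
  also have "\<dots> = (\<Sum>r\<in>coord_planes. (e $ fst r * x $ snd r) *\<^sub>R plane_gen r ?y)"
    by (rule sum_plane_gen[symmetric])
  finally have "f' (cos t *\<^sub>R e - sin t *\<^sub>R x) =
      (\<Sum>r\<in>coord_planes. (e $ fst r * x $ snd r) *\<^sub>R plane_deriv n r f ?y)"
    by (simp add: f'.sum f'.scaleR plane_deriv_eq_derivative[OF f f'])
  moreover have "((\<lambda>t. cos t *\<^sub>R x + sin t *\<^sub>R e) has_vector_derivative (cos t *\<^sub>R e - sin t *\<^sub>R x)) (at t)"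
    unfolding has_vector_derivative_def
    by (rule derivative_eq_intros refl)+ (auto simp: algebra_simps)
  then have "((\<lambda>t. f (cos t *\<^sub>R x + sin t *\<^sub>R e)) has_vector_derivative f' (cos t *\<^sub>R e - sin t *\<^sub>R x)) (at t)"
    using f' by (rule has_vector_derivative_compose)
  ultimately show ?thesis
    by (simp add: scaleR_conv_of_real)
qed

lemma norm_circle:
  fixes x e :: "'a::real_inner"
  assumes "norm x = 1" "norm e = 1" "x \<bullet> e = 0"
  shows "norm (cos t *\<^sub>R x + sin t *\<^sub>R e) = 1"
proof -
  have "(cos t *\<^sub>R x + sin t *\<^sub>R e) \<bullet> (cos t *\<^sub>R x + sin t *\<^sub>R e) = (cos t)\<^sup>2 + (sin t)\<^sup>2"
    using assms by (simp add: inner_add_left inner_add_right inner_commute[of e x] power2_eq_square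
        norm_eq_1)
  then show ?thesis
    by (simp add: norm_eq_sqrt_inner)
qed

text \<open>Orders 1 to \<open>M\<close> are taken at \<open>x\<close>; only the last term uses the
  sup bound \<open>C\<close>. The shape is dictated by the derivative in \<open>t\<close>: for
  \<open>Suc M\<close> it is the sum over \<open>r\<close> of
  \<open>cmod (plane_deriv n r f x)\<close> and the bound for \<open>M\<close>,
  \<open>plane_deriv n r f\<close> and \<open>n * C\<close>.\<close>

definition taylor_bound ::
    "nat \<Rightarrow> nat \<Rightarrow> (real ^ 'd \<Rightarrow> complex) \<Rightarrow> real ^ 'd \<Rightarrow> real \<Rightarrow> real \<Rightarrow> real" where
  "taylor_bound n M f x C t =
     (\<Sum>m<M. t ^ Suc m / fact (Suc m) * deriv_sum n (Suc m) f x) +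
     t ^ Suc M / fact (Suc M) * ((real (card (coord_planes :: ('d \<times> 'd) set)) * real n) ^ Suc M * C)"

lemma has_vector_derivative_power_fact:
  "((\<lambda>t::real. t ^ Suc m / fact (Suc m)) has_vector_derivative t ^ m / fact m) (at t)"
proof -
  have "((\<lambda>t::real. t ^ Suc m / fact (Suc m)) has_real_derivative
      (real (Suc m) * t ^ m) / fact (Suc m)) (at t)"
    using DERIV_pow[of "Suc m" t UNIV] by (intro DERIV_cdivide) simp
  then show ?thesis
    by (simp add: has_real_derivative_iff_has_vector_derivative del: of_nat_Suc)
qed

lemma taylor_bound:
  fixes f :: "real ^ 'd \<Rightarrow> complex"
  assumes f: "circle_trig n f" and C: "\<And>y. y \<in> sphere 0 1 \<Longrightarrow> cmod (f y) \<le> C"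
    and t: "0 \<le> t" and xe: "norm x = 1" "norm e = 1" "x \<bullet> e = 0"
  shows "cmod (f (cos t *\<^sub>R x + sin t *\<^sub>R e) - f x) \<le> taylor_bound n M f x C t"
  using f C t
proof (induction M arbitrary: f C t)
  let ?\<gamma> = "\<lambda>t. cos t *\<^sub>R x + sin t *\<^sub>R e"
  let ?K = "real (card (coord_planes :: ('d \<times> 'd) set))"
  have \<gamma>: "?\<gamma> s \<in> sphere 0 1" for s
    using norm_circle[OF xe] by simp
  have coord: "\<bar>e $ i * x $ j\<bar> \<le> 1" for i j
    using component_le_norm_cart[of e i] component_le_norm_cart[of x j] xe
    by (simp add: abs_mult mult_le_one)
  \<comment> \<open>Mean value inequality: the derivative of \<open>g\<close> along the circle has
    coefficients of modulus at most 1, so bounds \<open>\<psi> r\<close> on the plane derivatives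
    may be summed and integrated to \<open>\<phi>\<close>.\<close>
  have integrate: "cmod (g (?\<gamma> t) - g x) \<le> \<phi> t"
    if g: "circle_trig n g" and t: "0 \<le> t" and \<phi>0: "\<phi> 0 = 0"
      and \<phi>: "\<And>s. (\<phi> has_vector_derivative (\<Sum>r\<in>coord_planes. \<psi> r s)) (at s)"
      and bd: "\<And>r s. r \<in> coord_planes \<Longrightarrow> 0 \<le> s \<Longrightarrow> cmod (plane_deriv n r g (?\<gamma> s)) \<le> \<psi> r s"
    for g t and \<phi> :: "real \<Rightarrow> real" and \<psi> :: "'d \<times> 'd \<Rightarrow> real \<Rightarrow> real"
  proof (cases "t = 0")
    case True
    then show ?thesis using \<phi>0 by simp
  next
    case False
    have "cmod (g (?\<gamma> t) - g (?\<gamma> 0)) \<le> \<phi> t - \<phi> 0"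
    proof (rule differentiable_bound_general)
      show "0 < t" using t False by simp
      show "continuous_on {0..t} (\<lambda>t. g (?\<gamma> t))"
        by (intro continuous_on_compose2[OF circle_trig_continuous_on[OF g, of UNIV]]
            continuous_intros) auto
      show "continuous_on {0..t} \<phi>"
        using \<phi> has_vector_derivative_continuous continuous_at_imp_continuous_on by blast
      fix s assume s: "0 < s" "s < t"
      show "((\<lambda>t. g (?\<gamma> t)) has_vector_derivative
        (\<Sum>r\<in>coord_planes. of_real (e $ fst r * x $ snd r) * plane_deriv n r g (?\<gamma> s))) (at s)"
        by (rule has_vector_derivative_circle[OF g xe])
      show "(\<phi> has_vector_derivative (\<Sum>r\<in>coord_planes. \<psi> r s)) (at s)"
        by (rule \<phi>)
      show "cmod (\<Sum>r\<in>coord_planes. of_real (e $ fst r * x $ snd r) * plane_deriv n r g (?\<gamma> s))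
          \<le> (\<Sum>r\<in>coord_planes. \<psi> r s)"
      proof (rule sum_norm_le)
        fix r :: "'d \<times> 'd" assume r: "r \<in> coord_planes"
        have "cmod (of_real (e $ fst r * x $ snd r) * plane_deriv n r g (?\<gamma> s)) \<le>
            1 * cmod (plane_deriv n r g (?\<gamma> s))"
          unfolding norm_mult norm_of_real by (intro mult_right_mono coord) simp
        also have "\<dots> \<le> \<psi> r s"
          using bd[OF r] s by simp
        finally show "cmod (of_real (e $ fst r * x $ snd r) * plane_deriv n r g (?\<gamma> s)) \<le> \<psi> r s" .
      qed
    qed
    then show ?thesis using \<phi>0 by simp
  qed
  {
    case 0
    show ?case
    proof (rule integrate[OF \<open>circle_trig n f\<close> \<open>0 \<le> t\<close>, where \<psi> = "\<lambda>r s. real n * C"])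
      show "(taylor_bound n 0 f x C has_vector_derivative (\<Sum>r\<in>(coord_planes :: ('d \<times> 'd) set). real n * C)) (at s)" for s
        unfolding taylor_bound_def[abs_def]
        by (auto intro!: derivative_eq_intros simp: has_vector_derivative_def mult.assoc)
      show "cmod (plane_deriv n r f (?\<gamma> s)) \<le> real n * C" if "r \<in> coord_planes" for r s
        using that 0(2) \<gamma> by (intro plane_deriv_bound) auto
    qed (simp add: taylor_bound_def)
  next
    case (Suc M)
    \<comment> \<open>The value of \<open>plane_deriv n r f\<close> on the circle is its value at
      \<open>x\<close> plus an increment controlled by the induction hypothesis, whose sup bound has
      grown by the factor \<open>n\<close>.\<close>
    let ?\<psi> = "\<lambda>r s. deriv_sum n 0 (plane_deriv n r f) x + taylor_bound n M (plane_deriv n r f) x (real n * C) s"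
    show ?case
    proof (rule integrate[OF \<open>circle_trig n f\<close> \<open>0 \<le> t\<close>, where \<psi> = ?\<psi>])
      fix s
      have "(taylor_bound n (Suc M) f x C has_vector_derivative
          (\<Sum>m<Suc M. s ^ m / fact m * deriv_sum n (Suc m) f x) +
          s ^ Suc M / fact (Suc M) * ((?K * real n) ^ Suc (Suc M) * C)) (at s)"
        unfolding taylor_bound_def[abs_def]
        by (intro has_vector_derivative_add has_vector_derivative_sum has_vector_derivative_mult_left
            has_vector_derivative_power_fact)
      also have "(\<Sum>m<Suc M. s ^ m / fact m * deriv_sum n (Suc m) f x) =
          deriv_sum n (Suc 0) f x + (\<Sum>m<M. s ^ Suc m / fact (Suc m) * deriv_sum n (Suc (Suc m)) f x)"
        by (subst sum.lessThan_Suc_shift) simp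
      also have "\<dots> + s ^ Suc M / fact (Suc M) * ((?K * real n) ^ Suc (Suc M) * C) = (\<Sum>r\<in>coord_planes. ?\<psi> r s)"
      proof -
        have "(\<Sum>m<M. s ^ Suc m / fact (Suc m) * deriv_sum n (Suc (Suc m)) f x) =
            (\<Sum>r\<in>coord_planes. \<Sum>m<M. s ^ Suc m / fact (Suc m) * deriv_sum n (Suc m) (plane_deriv n r f) x)"
          by (subst sum.swap) (simp only: deriv_sum.simps(2)[of n "Suc _"] sum_distrib_left)
        then show ?thesis
          by (simp add: taylor_bound_def sum.distrib algebra_simps del: power_Suc fact_Suc of_nat_Suc)
             (simp add: algebra_simps)
      qed
      finally show "(taylor_bound n (Suc M) f x C has_vector_derivative (\<Sum>r\<in>coord_planes. ?\<psi> r s)) (at s)" .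
    next
      fix r :: "'d \<times> 'd" and s :: real assume r: "r \<in> coord_planes" and s: "0 \<le> s"
      have "cmod (plane_deriv n r f (?\<gamma> s) - plane_deriv n r f x) \<le>
          taylor_bound n M (plane_deriv n r f) x (real n * C) s"
        using Suc.prems r s by (intro Suc.IH circle_trig_plane_deriv plane_deriv_bound) auto
      then show "cmod (plane_deriv n r f (?\<gamma> s)) \<le> ?\<psi> r s"
        using norm_triangle_sub[of "plane_deriv n r f (?\<gamma> s)" "plane_deriv n r f x"] by simp
    qed (simp add: taylor_bound_def)
  }
qed

section \<open>Spherical harmonics are trigonometric on circles\<close>

text \<open>Homogeneous components, each with trigonometric degree equal to its grade.
  \<open>N\<close> is merely a cutoff beyond which all components vanish, so that decompositions of
  different length can be added.\<close>

definition graded_decomposition :: "(real ^ 'd \<Rightarrow> real) \<Rightarrow> nat \<Rightarrow> (nat \<Rightarrow> real ^ 'd \<Rightarrow> real) \<Rightarrow> bool" where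
  "graded_decomposition p N F \<longleftrightarrow> (\<forall>x. p x = (\<Sum>k\<le>N. F k x)) \<and> (\<forall>k>N. \<forall>x. F k x = 0) \<and>
     (\<forall>k t x. F k (t *\<^sub>R x) = t ^ k * F k x) \<and>
     (\<forall>k x y z. trig_poly k (\<lambda>t. of_real (F k (z + cos t *\<^sub>R x + sin t *\<^sub>R y))))"

lemma graded_decomposition_mono:
  assumes "graded_decomposition p N F" "N \<le> M"
  shows "graded_decomposition p M F"
proof -
  have "(\<Sum>k\<le>N. F k x) = (\<Sum>k\<le>M. F k x)" for x
    using assms by (intro sum.mono_neutral_left) (auto simp: graded_decomposition_def)
  then show ?thesis
    using assms by (simp add: graded_decomposition_def)
qed

lemma graded_decomposition_linear:
  fixes p :: "real ^ 'd \<Rightarrow> real"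
  assumes "bounded_linear p"
  shows "graded_decomposition p 1 (\<lambda>k. if k = 1 then p else (\<lambda>_. 0))"
proof -
  interpret bounded_linear p by fact
  have "trig_poly 1 (\<lambda>t. of_real (p (z + cos t *\<^sub>R x + sin t *\<^sub>R y)))" for x y z
  proof -
    have "trig_poly 1 (\<lambda>t. of_real (p z) + of_real (p x) * of_real (cos t) + of_real (p y) * of_real (sin t))"
      by (intro trig_poly_add trig_poly_cmult trig_poly_const trig_poly_cos trig_poly_sin)
    then show ?thesis
      by (simp add: add scaleR mult.commute)
  qed
  then show ?thesis
    by (auto simp: graded_decomposition_def scaleR intro: trig_poly_const[of _ 0, simplified])
qed

lemma graded_decomposition_const:
  "graded_decomposition (\<lambda>_. c) 0 (\<lambda>k _. if k = 0 then c else 0)"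
  by (auto simp: graded_decomposition_def intro: trig_poly_const)

lemma graded_decomposition_add:
  assumes "graded_decomposition p N F" "graded_decomposition p' N F'"
  shows "graded_decomposition (\<lambda>x. p x + p' x) N (\<lambda>k x. F k x + F' k x)"
  using assms by (auto simp: graded_decomposition_def sum.distrib distrib_left intro!: trig_poly_add)

lemma graded_decomposition_mult:
  fixes p p' :: "real ^ 'd \<Rightarrow> real"
  assumes "graded_decomposition p M F" "graded_decomposition p' N F'"
  shows "graded_decomposition (\<lambda>x. p x * p' x) (M + N) (\<lambda>k x. \<Sum>i\<le>k. F i x * F' (k - i) x)"
  unfolding graded_decomposition_def
proof (intro conjI allI impI)
  fix x
  show "p x * p' x = (\<Sum>k\<le>M + N. \<Sum>i\<le>k. F i x * F' (k - i) x)"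
    \<comment> \<open>The Cauchy product of two polynomials in an auxiliary variable with
      coefficients \<open>F k x\<close> and \<open>F' k x\<close>, evaluated at 1.\<close>
    using polynomial_product[of M "\<lambda>k. F k x" N "\<lambda>k. F' k x" 1] assms
    by (simp add: graded_decomposition_def)
next
  fix k x assume k: "M + N < k"
  have "F i x * F' (k - i) x = 0" for i
    using assms k by (cases "i > M") (auto simp: graded_decomposition_def)
  then show "(\<Sum>i\<le>k. F i x * F' (k - i) x) = 0" by (intro sum.neutral) auto
next
  fix k t and x :: "real ^ 'd"
  have "F i (t *\<^sub>R x) * F' (k - i) (t *\<^sub>R x) = t ^ k * (F i x * F' (k - i) x)" if "i \<le> k" for i
    using assms that power_add[of t i "k - i"] by (simp add: graded_decomposition_def mult_ac)
  then show "(\<Sum>i\<le>k. F i (t *\<^sub>R x) * F' (k - i) (t *\<^sub>R x)) = t ^ k * (\<Sum>i\<le>k. F i x * F' (k - i) x)"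
    by (simp add: sum_distrib_left)
next
  fix k and x y z :: "real ^ 'd"
  let ?\<gamma> = "\<lambda>t. z + cos t *\<^sub>R x + sin t *\<^sub>R y"
  have "trig_poly k (\<lambda>t. of_real (F i (?\<gamma> t)) * of_real (F' (k - i) (?\<gamma> t)))" if "i \<le> k" for i
  proof -
    have "trig_poly (i + (k - i)) (\<lambda>t. of_real (F i (?\<gamma> t)) * of_real (F' (k - i) (?\<gamma> t)))"
      using assms by (intro trig_poly_mult) (simp_all add: graded_decomposition_def)
    then show ?thesis using that by simp
  qed
  then show "trig_poly k (\<lambda>t. of_real (\<Sum>i\<le>k. F i (?\<gamma> t) * F' (k - i) (?\<gamma> t)))"
    by (simp only: of_real_sum of_real_mult) (intro trig_poly_sum, simp)
qed

lemma real_polynomial_function_graded: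
  fixes p :: "real ^ 'd \<Rightarrow> real"
  assumes "real_polynomial_function p"
  shows "\<exists>N F. graded_decomposition p N F"
  using assms
proof (induction rule: real_polynomial_function.induct)
  case (linear f)
  then show ?case using graded_decomposition_linear by blast
next
  case (const c)
  then show ?case using graded_decomposition_const by blast
next
  case (add f g)
  then obtain M F N G where "graded_decomposition f M F" "graded_decomposition g N G" by blast
  then have "graded_decomposition f (max M N) F" "graded_decomposition g (max M N) G"
    by (auto intro: graded_decomposition_mono)
  then show ?case using graded_decomposition_add by blast
next
  case (mult f g)
  then show ?case using graded_decomposition_mult by blast
qed

text \<open>A polynomial that is homogeneous of degree \<open>l\<close> equals its component of
  grade \<open>l\<close>: for fixed \<open>x\<close> both sides of \<open>p (t x) = t^l p x\<close>
  are polynomials in \<open>t\<close>, and their coefficients agree.\<close>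

lemma trig_poly_homogeneous:
  fixes p :: "real ^ 'd \<Rightarrow> real"
  assumes "real_polynomial_function p" and hom: "\<And>t x. p (t *\<^sub>R x) = t ^ l * p x"
  shows "trig_poly l (\<lambda>t. of_real (p (z + cos t *\<^sub>R x + sin t *\<^sub>R y)))"
proof -
  obtain N F where "graded_decomposition p N F"
    using real_polynomial_function_graded[OF assms(1)] by blast
  \<comment> \<open>The cutoff is raised so that the coefficient of index \<open>l\<close> takes
    part in the comparison.\<close>
  then have F: "graded_decomposition p (max N l) F"
    by (rule graded_decomposition_mono) simp
  have "p x = F l x" for x
  proof -
    have "(\<Sum>k\<le>max N l. F k x * t ^ k) = (\<Sum>k\<le>max N l. (if k = l then p x else 0) * t ^ k)" for t
    proof -
      have "(\<Sum>k\<le>max N l. F k x * t ^ k) = p (t *\<^sub>R x)"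
        using F by (simp add: graded_decomposition_def mult.commute)
      also have "\<dots> = (\<Sum>k\<le>max N l. (if k = l then p x * t ^ l else 0))"
        by (simp add: hom)
      also have "\<dots> = (\<Sum>k\<le>max N l. (if k = l then p x else 0) * t ^ k)"
        by (intro sum.cong) auto
      finally show ?thesis .
    qed
    then have "F k x = (if k = l then p x else 0)" if "k \<le> max N l" for k
      using that polyfun_eq_coeffs[of "\<lambda>k. F k x" "max N l" "\<lambda>k. if k = l then p x else 0"] by blast
    from this[of l] show ?thesis by simp
  qed
  then have "p = F l" by (rule ext)
  then show ?thesis
    using F unfolding graded_decomposition_def by blast
qed

lemma circle_trig_homogeneous_polynomial:
  fixes f :: "real ^ 'd \<Rightarrow> complex"
  assumes "homogeneous_polynomial l f"
  shows "circle_trig l f"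
  unfolding circle_trig_def
proof (intro conjI allI)
  have f: "polynomial_function f" and hom: "f (t *\<^sub>R x) = of_real t ^ l * f x" for t x
    using assms by (auto simp: homogeneous_polynomial_def)
  fix x y z :: "real ^ 'd"
  show "f differentiable (at x)"
    using f by (rule differentiable_at_polynomial_function)
  have "real_polynomial_function (Re \<circ> f)" "real_polynomial_function (Im \<circ> f)"
    using f bounded_linear_Re bounded_linear_Im unfolding polynomial_function_def by blast+
  moreover have "(Re \<circ> f) (t *\<^sub>R x) = t ^ l * (Re \<circ> f) x" "(Im \<circ> f) (t *\<^sub>R x) = t ^ l * (Im \<circ> f) x" for t x
    by (simp_all add: hom flip: of_real_power)
  ultimately have "trig_poly l (\<lambda>t. of_real ((Re \<circ> f) (z + cos t *\<^sub>R x + sin t *\<^sub>R y)))"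
    "trig_poly l (\<lambda>t. of_real ((Im \<circ> f) (z + cos t *\<^sub>R x + sin t *\<^sub>R y)))"
    by (blast intro: trig_poly_homogeneous)+
  moreover have "(Re \<circ> f) (t *\<^sub>R x) = t ^ l * (Re \<circ> f) x" "(Im \<circ> f) (t *\<^sub>R x) = t ^ l * (Im \<circ> f) x" for t x
    by (simp_all add: hom flip: of_real_power)
  ultimately have "trig_poly l (\<lambda>t. of_real ((Re \<circ> f) (z + cos t *\<^sub>R x + sin t *\<^sub>R y)) +
      \<i> * of_real ((Im \<circ> f) (z + cos t *\<^sub>R x + sin t *\<^sub>R y)))"
    by (intro trig_poly_add trig_poly_cmult)
  then show "trig_poly l (\<lambda>t. f (z + cos t *\<^sub>R x + sin t *\<^sub>R y))"
    by (simp flip: complex_eq)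
qed

text \<open>\<open>P\<close> is determined only on the sphere, while differentiation takes place in
  the ambient space; \<open>P\<close> is therefore exchanged for a polynomial
  representative.\<close>

lemma harmonics_upto_circle_trig:
  assumes "P \<in> harmonics_upto n"
  shows "\<exists>f. circle_trig n f \<and> (\<forall>x\<in>sphere 0 1. P x = f x)"
proof -
  obtain Y where Y: "\<And>l. l \<le> n \<Longrightarrow> Y l \<in> harmonics l" and P: "P = (\<lambda>x. \<Sum>l\<le>n. Y l x)"
    using assms by (auto simp: harmonics_upto_def)
  have "\<forall>l\<in>{..n}. \<exists>f. harmonic_polynomial l f \<and> (\<forall>x\<in>sphere 0 1. Y l x = f x)"
    using Y unfolding harmonics_def by blast
  then obtain f where f: "\<And>l. l \<le> n \<Longrightarrow> harmonic_polynomial l (f l)"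
    and Yf: "\<And>l x. l \<le> n \<Longrightarrow> x \<in> sphere 0 1 \<Longrightarrow> Y l x = f l x"
    by (metis atMost_iff)
  have "circle_trig n (\<lambda>x. \<Sum>l\<le>n. f l x)"
  proof (rule circle_trig_sum)
    fix l assume "l \<in> {..n}"
    then have "homogeneous_polynomial l (f l)" "l \<le> n"
      using f by (auto simp: harmonic_polynomial_def)
    then show "circle_trig n (f l)"
      using circle_trig_homogeneous_polynomial circle_trig_mono by blast
  qed simp
  moreover have "\<forall>x\<in>sphere 0 1. P x = (\<Sum>l\<le>n. f l x)"
    using Yf by (auto simp: P)
  ultimately show ?thesis by blast
qed

section \<open>Rotation invariance of the surface measure\<close>

lemma borel_measurable_linear:
  fixes T :: "'a::euclidean_space \<Rightarrow> 'b::euclidean_space"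
  shows "linear T \<Longrightarrow> T \<in> borel_measurable borel"
  by (simp add: borel_measurable_continuous_onI linear_continuous_on linear_conv_bounded_linear)

lemma nn_integral_lborel_translation:
  fixes h :: "'a::euclidean_space \<Rightarrow> ennreal"
  assumes "h \<in> borel_measurable borel"
  shows "(\<integral>\<^sup>+y. h (c + y) \<partial>lborel) = (\<integral>\<^sup>+y. h y \<partial>lborel)"
proof -
  have "(\<integral>\<^sup>+y. h y \<partial>lborel) = (\<integral>\<^sup>+y. h y \<partial>distr lborel borel ((+) c))"
    by (simp add: lborel_distr_plus)
  also have "\<dots> = (\<integral>\<^sup>+y. h (c + y) \<partial>lborel)"
    using assms by (intro nn_integral_distr) auto
  finally show ?thesis ..
qed

text \<open>The library proves this only over a well-ordered index type. Here the two measures are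
  compared through a double integral against the unit ball, which the map preserves.\<close>

lemma nn_integral_lborel_orthogonal:
  fixes T :: "'a::euclidean_space \<Rightarrow> 'a" and g :: "'a \<Rightarrow> ennreal"
  assumes T: "orthogonal_transformation T" and g [measurable]: "g \<in> borel_measurable borel"
  shows "(\<integral>\<^sup>+y. g (T y) \<partial>lborel) = (\<integral>\<^sup>+y. g y \<partial>lborel)"
proof -
  define f where "f = (indicator (ball 0 1) :: 'a \<Rightarrow> ennreal)"
  have [measurable]: "f \<in> borel_measurable borel"
    unfolding f_def by (intro borel_measurable_indicator borel_open open_ball)
  let ?V = "emeasure lborel (ball (0::'a) 1)"
  have linT: "linear T"
    using T by (rule orthogonal_transformation_linear)
  have [measurable]: "T \<in> borel_measurable borel"
    using linT by (rule borel_measurable_linear)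
  obtain S where S: "\<And>x. T (S x) = x"
    using orthogonal_transformation_surj[OF T] by (metis surjD)
  have ball: "emeasure lborel (ball w 1) = ?V" for w :: 'a
    by (simp add: emeasure_ball)
  have "unit_ball_vol (real DIM('a)) \<noteq> 0"
    using unit_ball_vol_pos[of "real DIM('a)", OF of_nat_0_le_iff] by (metis less_irrefl)
  then have V: "?V \<noteq> 0" "?V \<noteq> \<infinity>"
    by (simp_all add: emeasure_ball)
  have "?V * (\<integral>\<^sup>+y. g (T y) \<partial>lborel) = (\<integral>\<^sup>+x. f x * (\<integral>\<^sup>+y. g (T y) \<partial>lborel) \<partial>lborel)"
    by (subst nn_integral_multc) (simp_all add: f_def borel_open borel_measurable_indicator)
  also have "\<dots> = (\<integral>\<^sup>+x. \<integral>\<^sup>+y. f x * g (x + T y) \<partial>lborel \<partial>lborel)"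
  proof (rule nn_integral_cong)
    fix x
    \<comment> \<open>Pulling \<open>x\<close> through \<open>T\<close> makes the inner integral a
      translate, which puts the factor \<open>f x\<close> under it at no cost.\<close>
    have "x + T y = T (S x + y)" for y
      by (simp add: linear_add[OF linT] S)
    then show "f x * (\<integral>\<^sup>+y. g (T y) \<partial>lborel) = (\<integral>\<^sup>+y. f x * g (x + T y) \<partial>lborel)"
      using nn_integral_lborel_translation[of "\<lambda>y. g (T y)" "S x"] by (simp add: nn_integral_cmult)
  qed
  also have "\<dots> = (\<integral>\<^sup>+y. \<integral>\<^sup>+x. f x * g (x + T y) \<partial>lborel \<partial>lborel)"
    by (rule lborel_pair.Fubini'[symmetric]) measurable
  also have "\<dots> = (\<integral>\<^sup>+y. \<integral>\<^sup>+x. f (x - T y) * g x \<partial>lborel \<partial>lborel)"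
  proof (rule nn_integral_cong)
    fix y
    show "(\<integral>\<^sup>+x. f x * g (x + T y) \<partial>lborel) = (\<integral>\<^sup>+x. f (x - T y) * g x \<partial>lborel)"
      using nn_integral_lborel_translation[of "\<lambda>x. f (x - T y) * g x" "T y"] by (simp add: add.commute)
  qed
  also have "\<dots> = (\<integral>\<^sup>+x. \<integral>\<^sup>+y. f (x - T y) * g x \<partial>lborel \<partial>lborel)"
    by (rule lborel_pair.Fubini') measurable
  also have "\<dots> = (\<integral>\<^sup>+x. ?V * g x \<partial>lborel)"
  proof (rule nn_integral_cong)
    fix x
    \<comment> \<open>Here orthogonality is used: in the variable \<open>y\<close> the indicator
      describes a unit ball about \<open>S x\<close>, whose volume does not depend on
      \<open>x\<close>.\<close>
    have "norm (x - T y) = norm (S x - y)" for y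
      using orthogonal_transformation_norm[OF T, of "S x - y"]
      unfolding linear_diff[OF linT] S .
    then have "f (x - T y) = indicator (ball (S x) 1) y" for y
      unfolding f_def indicator_def mem_ball dist_norm by (simp only: diff_0 norm_minus_cancel)
    then have "(\<integral>\<^sup>+y. f (x - T y) * g x \<partial>lborel) = (\<integral>\<^sup>+y. indicator (ball (S x) 1) y * g x \<partial>lborel)"
      by (simp only:)
    also have "\<dots> = (\<integral>\<^sup>+y. indicator (ball (S x) 1) y \<partial>lborel) * g x"
      by (rule nn_integral_multc) (simp add: borel_measurable_indicator)
    also have "\<dots> = ?V * g x"
      by (simp only: nn_integral_indicator sets_lborel borel_open open_ball ball[of "S x"])
    finally show "(\<integral>\<^sup>+y. f (x - T y) * g x \<partial>lborel) = ?V * g x" .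
  qed
  also have "\<dots> = ?V * (\<integral>\<^sup>+x. g x \<partial>lborel)"
    by (simp add: nn_integral_cmult)
  finally show ?thesis
    using V by (simp add: ennreal_mult_cancel_left)
qed

lemma emeasure_lborel_orthogonal_vimage:
  fixes T :: "'a::euclidean_space \<Rightarrow> 'a"
  assumes "orthogonal_transformation T" "A \<in> sets borel"
  shows "emeasure lborel (T -` A) = emeasure lborel A"
proof -
  have [measurable]: "T \<in> borel_measurable borel"
    using orthogonal_transformation_linear[OF assms(1)] by (rule borel_measurable_linear)
  have "T -` A \<in> sets borel"
    using measurable_sets[of T borel borel A] assms(2) by simp
  moreover have "(indicator A (T y) :: ennreal) = indicator (T -` A) y" for y
    by (simp add: indicator_def)
  ultimately show ?thesis
    using nn_integral_lborel_orthogonal[OF assms(1), of "indicator A"] assms(2) by simp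
qed

lemma cone_measurable:
  fixes A :: "(real ^ 'd) set"
  assumes "A \<in> sets borel" "A \<subseteq> sphere 0 1"
  shows "{t *\<^sub>R x | t x. 0 < t \<and> t \<le> 1 \<and> x \<in> A} \<in> sets borel"
proof -
  let ?g = "\<lambda>x :: real ^ 'd. x /\<^sub>R norm x"
  have "?g -` A \<inter> space borel \<in> sets borel"
    by (rule measurable_sets[OF _ assms(1)]) measurable
  moreover have "{t *\<^sub>R x | t x. 0 < t \<and> t \<le> 1 \<and> x \<in> A} = ?g -` A \<inter> (cball 0 1 - {0})" (is "?C = _")
  proof (intro set_eqI iffI)
    fix y assume y: "y \<in> ?g -` A \<inter> (cball 0 1 - {0})"
    then have "y = norm y *\<^sub>R ?g y" "0 < norm y" "norm y \<le> 1" "?g y \<in> A" by auto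
    then show "y \<in> ?C" by blast
  next
    fix y assume "y \<in> ?C"
    then obtain t x where tx: "y = t *\<^sub>R x" "0 < t" "t \<le> 1" "x \<in> A" by blast
    moreover have "norm x = 1" using tx assms(2) by auto
    ultimately show "y \<in> ?g -` A \<inter> (cball 0 1 - {0})" by auto
  qed
  ultimately show ?thesis by auto
qed

text \<open>A linear isometry commutes with scaling, so the cone over a preimage is the preimage of
  the cone, and the claim reduces to Lebesgue measure.\<close>

lemma emeasure_sphere_measure_orthogonal:
  fixes T :: "real ^ 'd \<Rightarrow> real ^ 'd"
  assumes T: "orthogonal_transformation T" and A: "A \<in> sets borel" "A \<subseteq> sphere 0 1"
  shows "emeasure sphere_measure (T -` A) = emeasure sphere_measure A"
proof -
  have linT: "linear T" and normT: "norm (T x) = norm x" for x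
    using T orthogonal_transformation_linear orthogonal_transformation_norm by blast+
  have "T \<in> borel_measurable borel"
    using linT by (rule borel_measurable_linear)
  then have TA: "T -` A \<in> sets borel" "T -` A \<subseteq> sphere 0 1"
    using measurable_sets[of T borel borel A] A normT by auto
  have eq: "{t *\<^sub>R x | t x. 0 < t \<and> t \<le> 1 \<and> x \<in> T -` A} =
      T -` {t *\<^sub>R x | t x. 0 < t \<and> t \<le> 1 \<and> x \<in> A}"
    (is "?L = T -` ?R")
  proof (intro set_eqI iffI)
    fix y assume "y \<in> ?L"
    then obtain t x where "y = t *\<^sub>R x" "0 < t" "t \<le> 1" "T x \<in> A" by auto
    then have "T y = t *\<^sub>R T x \<and> 0 < t \<and> t \<le> 1 \<and> T x \<in> A"
      by (simp add: linear_scale[OF linT])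
    then show "y \<in> T -` ?R" by blast
  next
    fix y assume "y \<in> T -` ?R"
    then obtain t x where tx: "T y = t *\<^sub>R x" "0 < t" "t \<le> 1" "x \<in> A" by auto
    then have "T (y /\<^sub>R t) = x" by (simp add: linear_scale[OF linT])
    with tx have "y = t *\<^sub>R (y /\<^sub>R t) \<and> 0 < t \<and> t \<le> 1 \<and> y /\<^sub>R t \<in> T -` A" by simp
    then show "y \<in> ?L" by blast
  qed
  show ?thesis
    by (simp only: eq emeasure_sphere_measure_borel[OF TA] emeasure_sphere_measure_borel[OF A]
        emeasure_lborel_orthogonal_vimage[OF T cone_measurable[OF A]])
qed

lemma sets_sphere_measure_borel:
  fixes A :: "(real ^ 'd) set"
  assumes "A \<in> sets borel" "A \<subseteq> sphere 0 1"
  shows "A \<in> sets sphere_measure"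
  unfolding sphere_measure_def using assms
  by (intro sets_completionI_sets) (simp add: sets_restrict_space_iff)

lemma integral_sphere_measure_orthogonal:
  fixes T :: "real ^ 'd \<Rightarrow> real ^ 'd" and g :: "real ^ 'd \<Rightarrow> real"
  assumes T: "orthogonal_transformation T" and g: "continuous_on (sphere 0 1) g"
  shows "(\<integral>x. g (T x) \<partial>sphere_measure) = (\<integral>x. g x \<partial>sphere_measure)"
proof -
  let ?B = "restrict_space borel (sphere 0 1 :: (real ^ 'd) set)"
  \<comment> \<open>\<open>M\<close> is the surface measure before completion. Image measures are
    compared on Borel sets, where the cone formula applies, and Borel functions have the same
    integral for \<open>M\<close> and its completion.\<close>
  define M where "M = distr (scale_measure (of_nat CARD('d)) (restrict_space lborel (cball 0 1 - {0})))
    ?B (\<lambda>x. x /\<^sub>R norm x)"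
  have \<sigma>: "sphere_measure = completion M"
    unfolding sphere_measure_def M_def ..
  have setsM: "sets M = sets ?B" and spaceM: "space M = sphere 0 1"
    unfolding M_def by (simp_all only: sets_distr space_distr space_restrict_space) simp
  have linT: "linear T" and normT: "norm (T x) = norm x" for x
    using T orthogonal_transformation_linear orthogonal_transformation_norm by blast+
  have TB: "T \<in> ?B \<rightarrow>\<^sub>M ?B"
    using measurable_restrict_space1[OF borel_measurable_linear[OF linT]]
    by (rule measurable_restrict_space2[rotated]) (auto simp: space_restrict_space normT)
  have TM: "T \<in> M \<rightarrow>\<^sub>M M"
    using TB by (simp add: measurable_cong_sets[OF setsM setsM])
  have gM: "g \<in> borel_measurable M"
    unfolding measurable_cong_sets[OF setsM refl] using g by (rule borel_measurable_continuous_on_restrict)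
  have gTM: "(\<lambda>x. g (T x)) \<in> borel_measurable M"
    using TM gM by (rule measurable_compose)
  have "distr M M T = M"
  proof (rule measure_eqI)
    fix A assume "A \<in> sets (distr M M T)"
    then have AM: "A \<in> sets M" by simp
    then have A: "A \<in> sets borel" "A \<subseteq> sphere 0 1"
      unfolding setsM by (auto simp: sets_restrict_space_iff)
    have vim: "T -` A \<inter> space M = T -` A"
      using A(2) normT by (auto simp: spaceM)
    have "T -` A \<in> sets M"
      using measurable_sets[OF TM AM] by (simp add: vim)
    then have "emeasure M (T -` A) = emeasure sphere_measure (T -` A)"
      by (simp add: \<sigma>)
    also have "\<dots> = emeasure sphere_measure A"
      using T A by (rule emeasure_sphere_measure_orthogonal)
    also have "\<dots> = emeasure M A"
      using AM by (simp add: \<sigma>)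
    finally show "emeasure (distr M M T) A = emeasure M A"
      using TM AM by (simp add: emeasure_distr vim)
  qed simp
  then have "(\<integral>x. g x \<partial>M) = (\<integral>x. g (T x) \<partial>M)"
    using integral_distr[OF TM gM] by simp
  then show ?thesis
    unfolding \<sigma> by (simp add: integral_completion gM gTM)
qed

text \<open>The cone over a nonempty relatively open set contains a nonempty open set of the ambient
  space: the part of the open unit ball without its centre that projects radially into
  \<open>U\<close>. Thus essential suprema of continuous functions are suprema, and patches with
  interior points have positive measure.\<close>

lemma emeasure_sphere_measure_open_pos:
  fixes U :: "(real ^ 'd) set"
  assumes "open U" "U \<inter> sphere 0 1 \<noteq> {}"
  shows "emeasure sphere_measure (U \<inter> sphere 0 1) > 0"
proof -
  let ?g = "\<lambda>x :: real ^ 'd. x /\<^sub>R norm x"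
  let ?V = "?g -` U \<inter> (ball 0 1 - {0})"
  have C: "{t *\<^sub>R x | t x. 0 < t \<and> t \<le> 1 \<and> x \<in> U \<inter> sphere 0 1} \<in> sets borel" (is "?C \<in> _")
    using assms(1) by (intro cone_measurable) auto
  have "continuous_on (ball 0 1 - {0}) ?g"
    by (intro continuous_intros) auto
  moreover have "open (ball 0 1 - {0 :: real ^ 'd})"
    by (intro open_delete open_ball)
  ultimately have "open ((ball 0 1 - {0}) \<inter> ?g -` U)"
    using assms(1) by (rule continuous_open_preimage)
  then have "open ?V"
    by (simp only: Int_commute)
  obtain x where x: "x \<in> U" "norm x = 1"
    using assms(2) by auto
  then have "(1/2) *\<^sub>R x \<in> ?V" by auto
  then have "\<not> negligible ?V"
    using \<open>open ?V\<close> open_not_negligible by blast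
  moreover have "?V \<subseteq> ?C"
  proof
    fix y assume y: "y \<in> ?V"
    then have "y = norm y *\<^sub>R ?g y" "0 < norm y" "norm y \<le> 1" "?g y \<in> U \<inter> sphere 0 1" by auto
    then show "y \<in> ?C" by blast
  qed
  ultimately have "\<not> negligible ?C"
    using negligible_subset by blast
  then have "emeasure lborel ?C \<noteq> 0"
    using C by (auto simp: negligible_iff_null_sets null_sets_def)
  then show ?thesis
    using emeasure_sphere_measure_borel[of "U \<inter> sphere 0 1"] assms(1)
    by (simp add: ennreal_zero_less_mult_iff zero_less_iff_neq_zero)
qed

lemma finite_measure_sphere_measure: "finite_measure (sphere_measure :: (real ^ 'd) measure)"
  by (rule finite_measureI) (simp add: space_sphere_measure emeasure_sphere_measure_total)

lemma borel_measurable_sphere_measure: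
  fixes g :: "real ^ 'd \<Rightarrow> 'b::topological_space"
  assumes "continuous_on (sphere 0 1) g"
  shows "g \<in> borel_measurable sphere_measure"
  unfolding sphere_measure_def
  by (rule measurable_completion)
     (simp add: measurable_distr_eq1 borel_measurable_continuous_on_restrict[OF assms])

section \<open>Power means\<close>

text \<open>For positive arguments this is convexity of the power function; if one argument is 0 it
  reduces to \<open>u powr p \<le> u\<close> on the unit interval.\<close>

lemma powr_convex_nonneg:
  fixes p x y s t :: real
  assumes "1 \<le> p" "0 \<le> x" "0 \<le> y" "0 \<le> s" "0 \<le> t" "s + t = 1"
  shows "(s * x + t * y) powr p \<le> s * x powr p + t * y powr p"
proof -
  have zero: "(u * z) powr p \<le> u * z powr p" if "0 \<le> u" "u \<le> 1" "0 \<le> z" for u z :: real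
  proof -
    have "u powr p \<le> u powr 1"
      using that assms(1) by (intro powr_mono') auto
    then have "u powr p * z powr p \<le> u * z powr p"
      using that by (intro mult_right_mono) auto
    then show ?thesis using that by (simp add: powr_mult)
  qed
  consider "x = 0" | "y = 0" | "0 < x" "0 < y"
    using assms by linarith
  then show ?thesis
  proof cases
    case 3
    have s: "s = 1 - t"
      using assms(6) by simp
    show ?thesis
      using convex_onD[OF powr_convex[OF assms(1)], of t x y] assms 3 unfolding s by simp
  qed (use zero assms in auto)
qed

text \<open>A class closed under linear combinations whose members have integrable powers over every
  finite measure, so that no integral below falls back on its default value 0.\<close>

definition bdd_measurable :: "'a measure \<Rightarrow> ('a \<Rightarrow> real) \<Rightarrow> bool" where
  "bdd_measurable M f \<longleftrightarrow> f \<in> borel_measurable M \<and> (\<exists>C. \<forall>x\<in>space M. \<bar>f x\<bar> \<le> C)"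

definition power_mean :: "'a measure \<Rightarrow> real \<Rightarrow> ('a \<Rightarrow> real) \<Rightarrow> real" where
  "power_mean M p f = (\<integral>x. \<bar>f x\<bar> powr p \<partial>M) powr (1 / p)"

lemma bdd_measurable_const: "bdd_measurable M (\<lambda>_. c)"
  by (auto simp: bdd_measurable_def)

lemma bdd_measurable_add:
  assumes "bdd_measurable M f" "bdd_measurable M g"
  shows "bdd_measurable M (\<lambda>x. f x + g x)"
proof -
  obtain C D where C: "\<And>x. x \<in> space M \<Longrightarrow> \<bar>f x\<bar> \<le> C" and D: "\<And>x. x \<in> space M \<Longrightarrow> \<bar>g x\<bar> \<le> D"
    using assms by (auto simp: bdd_measurable_def)
  have "\<bar>f x + g x\<bar> \<le> C + D" if "x \<in> space M" for x
    using C[OF that] D[OF that] by linarith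
  then show ?thesis
    using assms by (auto simp: bdd_measurable_def)
qed

lemma bdd_measurable_cmult:
  assumes "bdd_measurable M f"
  shows "bdd_measurable M (\<lambda>x. c * f x)"
proof -
  obtain C where C: "\<And>x. x \<in> space M \<Longrightarrow> \<bar>f x\<bar> \<le> C"
    using assms by (auto simp: bdd_measurable_def)
  have "\<bar>c * f x\<bar> \<le> \<bar>c\<bar> * C" if "x \<in> space M" for x
    using C[OF that] by (simp add: abs_mult mult_left_mono)
  then show ?thesis
    using assms by (auto simp: bdd_measurable_def)
qed

lemma bdd_measurable_sum:
  assumes "\<And>i. i \<in> I \<Longrightarrow> bdd_measurable M (f i)"
  shows "bdd_measurable M (\<lambda>x. \<Sum>i\<in>I. f i x)"
  using assms
  by (induction I rule: infinite_finite_induct) (auto intro: bdd_measurable_const bdd_measurable_add)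

lemma integrable_power_bdd:
  assumes "finite_measure M" "bdd_measurable M f" "0 \<le> p"
  shows "integrable M (\<lambda>x. \<bar>f x\<bar> powr p)"
proof -
  interpret finite_measure M by fact
  obtain C where C: "\<And>x. x \<in> space M \<Longrightarrow> \<bar>f x\<bar> \<le> C" and [measurable]: "f \<in> borel_measurable M"
    using assms(2) by (auto simp: bdd_measurable_def)
  have "norm (\<bar>f x\<bar> powr p) \<le> C powr p" if "x \<in> space M" for x
    using C[OF that] assms(3) by (simp add: powr_mono2)
  then show ?thesis
    by (intro integrable_const_bound[where B = "C powr p"] AE_I2) auto
qed

lemma power_mean_nonneg: "0 \<le> power_mean M p f"
  by (simp add: power_mean_def)

lemma power_mean_powr:
  assumes "0 < p"
  shows "power_mean M p f powr p = (\<integral>x. \<bar>f x\<bar> powr p \<partial>M)"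
  using assms by (simp add: power_mean_def powr_powr)

lemma power_mean_le_iff:
  assumes "0 < p" "0 \<le> c"
  shows "power_mean M p f \<le> c \<longleftrightarrow> (\<integral>x. \<bar>f x\<bar> powr p \<partial>M) \<le> c powr p"
proof
  assume "power_mean M p f \<le> c"
  then have "power_mean M p f powr p \<le> c powr p"
    using assms power_mean_nonneg by (intro powr_mono2) auto
  then show "(\<integral>x. \<bar>f x\<bar> powr p \<partial>M) \<le> c powr p"
    using assms by (simp add: power_mean_powr)
next
  assume "(\<integral>x. \<bar>f x\<bar> powr p \<partial>M) \<le> c powr p"
  then have "power_mean M p f \<le> (c powr p) powr (1 / p)"
    unfolding power_mean_def using assms by (intro powr_mono2) auto
  then show "power_mean M p f \<le> c"
    using assms by (simp add: powr_powr)
qed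

lemma power_mean_mono:
  assumes "finite_measure M" "bdd_measurable M f" "bdd_measurable M g" "0 < p"
    and "AE x in M. \<bar>f x\<bar> \<le> \<bar>g x\<bar>"
  shows "power_mean M p f \<le> power_mean M p g"
proof -
  have "AE x in M. \<bar>f x\<bar> powr p \<le> \<bar>g x\<bar> powr p"
    using assms(5) by eventually_elim (use assms(4) in \<open>auto intro: powr_mono2\<close>)
  then have "(\<integral>x. \<bar>f x\<bar> powr p \<partial>M) \<le> (\<integral>x. \<bar>g x\<bar> powr p \<partial>M)"
    using assms(1-4) by (intro integral_mono_AE integrable_power_bdd) auto
  then show ?thesis
    unfolding power_mean_def using assms(4) by (intro powr_mono2) auto
qed

lemma power_mean_cmult:
  assumes "0 < p"
  shows "power_mean M p (\<lambda>x. c * f x) = \<bar>c\<bar> * power_mean M p f"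
  using assms by (simp add: power_mean_def abs_mult powr_mult powr_powr)

lemma power_mean_triangle:
  assumes M: "finite_measure M" and f: "bdd_measurable M f" and g: "bdd_measurable M g" and p: "1 \<le> p"
  shows "power_mean M p (\<lambda>x. f x + g x) \<le> power_mean M p f + power_mean M p g"
proof (rule field_le_epsilon)
  fix e :: real assume e: "0 < e"
  \<comment> \<open>The halves of \<open>e\<close> keep both numbers positive even if a norm
    vanishes, so that division by them is harmless.\<close>
  define a b where "a = power_mean M p f + e / 2" and "b = power_mean M p g + e / 2"
  have ab: "0 < a" "0 < b"
    using e power_mean_nonneg[of M p f] power_mean_nonneg[of M p g] by (auto simp: a_def b_def)
  have fa: "(\<integral>x. \<bar>f x\<bar> powr p \<partial>M) \<le> a powr p" and gb: "(\<integral>x. \<bar>g x\<bar> powr p \<partial>M) \<le> b powr p"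
    using p ab e power_mean_le_iff[of p a M f] power_mean_le_iff[of p b M g] by (auto simp: a_def b_def)
  \<comment> \<open>Convexity is applied to \<open>\<bar>f x\<bar> / a\<close> and
    \<open>\<bar>g x\<bar> / b\<close> with weights \<open>a / (a + b)\<close> and
    \<open>b / (a + b)\<close>. The factors collected here satisfy
    \<open>A a^p + B b^p = (a + b)^p\<close>.\<close>
  define A B where "A = (a + b) powr p * (a / (a + b)) / a powr p"
    and "B = (a + b) powr p * (b / (a + b)) / b powr p"
  have AB: "0 \<le> A" "0 \<le> B"
    using ab by (auto simp: A_def B_def)
  have point: "\<bar>f x + g x\<bar> powr p \<le> A * \<bar>f x\<bar> powr p + B * \<bar>g x\<bar> powr p" for x
  proof -
    have "\<bar>f x + g x\<bar> powr p \<le> (\<bar>f x\<bar> + \<bar>g x\<bar>) powr p"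
      using p by (intro powr_mono2) auto
    also have "\<bar>f x\<bar> + \<bar>g x\<bar> = (a + b) * (a / (a + b) * (\<bar>f x\<bar> / a) + b / (a + b) * (\<bar>g x\<bar> / b))"
      using ab by (simp add: distrib_left)
    also have "\<dots> powr p = (a + b) powr p * (a / (a + b) * (\<bar>f x\<bar> / a) + b / (a + b) * (\<bar>g x\<bar> / b)) powr p"
      by (rule powr_mult)
    also have "\<dots> \<le> (a + b) powr p *
        (a / (a + b) * (\<bar>f x\<bar> / a) powr p + b / (a + b) * (\<bar>g x\<bar> / b) powr p)"
      using ab p by (intro mult_left_mono powr_convex_nonneg) (auto simp: add_divide_distrib[symmetric])
    also have "\<dots> = A * \<bar>f x\<bar> powr p + B * \<bar>g x\<bar> powr p"
      using ab by (simp add: A_def B_def powr_divide distrib_left)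
    finally show ?thesis .
  qed
  have "(\<integral>x. \<bar>f x + g x\<bar> powr p \<partial>M) \<le> (\<integral>x. A * \<bar>f x\<bar> powr p + B * \<bar>g x\<bar> powr p \<partial>M)"
  proof (rule integral_mono)
    show "integrable M (\<lambda>x. \<bar>f x + g x\<bar> powr p)"
      using p by (intro integrable_power_bdd M bdd_measurable_add f g) simp
    show "integrable M (\<lambda>x. A * \<bar>f x\<bar> powr p + B * \<bar>g x\<bar> powr p)"
      using M f g p by (simp add: integrable_power_bdd)
  qed (rule point)
  also have "\<dots> = A * (\<integral>x. \<bar>f x\<bar> powr p \<partial>M) + B * (\<integral>x. \<bar>g x\<bar> powr p \<partial>M)"
    using M f g p by (simp add: integrable_power_bdd)
  also have "\<dots> \<le> A * a powr p + B * b powr p"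
    using AB fa gb by (intro add_mono mult_left_mono) auto
  also have "\<dots> = (a + b) powr p * (a / (a + b) + b / (a + b))"
    using ab by (simp add: A_def B_def distrib_left)
  also have "\<dots> = (a + b) powr p"
    using ab by (simp add: add_divide_distrib[symmetric])
  finally have "power_mean M p (\<lambda>x. f x + g x) \<le> a + b"
    using p ab by (subst power_mean_le_iff) auto
  then show "power_mean M p (\<lambda>x. f x + g x) \<le> power_mean M p f + power_mean M p g + e"
    by (simp add: a_def b_def)
qed

lemma power_mean_zero: "power_mean M p (\<lambda>_. 0) = 0"
  by (simp add: power_mean_def)

lemma power_mean_sum:
  assumes M: "finite_measure M" and p: "1 \<le> p" and f: "\<And>i. i \<in> I \<Longrightarrow> bdd_measurable M (f i)"
  shows "power_mean M p (\<lambda>x. \<Sum>i\<in>I. f i x) \<le> (\<Sum>i\<in>I. power_mean M p (f i))"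
  using f
proof (induction I rule: infinite_finite_induct)
  case (insert i I)
  have "power_mean M p (\<lambda>x. f i x + (\<Sum>i\<in>I. f i x)) \<le> power_mean M p (f i) + power_mean M p (\<lambda>x. \<Sum>i\<in>I. f i x)"
    using M p insert.prems by (intro power_mean_triangle bdd_measurable_sum) auto
  then show ?case
    using insert by fastforce
qed (simp_all add: power_mean_zero)

lemma Lp_norm_eq_power_mean: "Lp_norm M (ereal p) f = power_mean M p (\<lambda>x. cmod (f x))"
  by (simp add: Lp_norm_def power_mean_def)

text \<open>The essential supremum lies between 0 and \<open>C\<close>, so its conversion to a real
  number loses nothing. The lower bound 0 comes from the essential supremum of a constant, which
  requires a space of nonzero measure.\<close>

lemma Lp_norm_infinity:
  assumes f: "f \<in> borel_measurable M" and bdd: "\<And>x. x \<in> space M \<Longrightarrow> cmod (f x) \<le> C"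
    and M: "emeasure M (space M) \<noteq> 0"
  shows "AE x in M. cmod (f x) \<le> Lp_norm M \<infinity> f"
    and "(AE x in M. cmod (f x) \<le> c) \<Longrightarrow> Lp_norm M \<infinity> f \<le> c"
proof -
  let ?u = "\<lambda>x. ereal (cmod (f x))"
  let ?E = "esssup M ?u"
  have u: "?u \<in> borel_measurable M"
    using f by measurable
  have le: "?E \<le> ereal c" if "AE x in M. cmod (f x) \<le> c" for c
    using u that by (intro esssup_I) auto
  have "?E \<le> ereal C"
    using bdd by (intro le AE_I2)
  moreover have "0 \<le> ?E"
  proof -
    have "esssup M (\<lambda>x. 0::ereal) \<le> ?E"
      by (rule esssup_mono) auto
    then show ?thesis using esssup_const[OF M, of "0::ereal"] by simp
  qed
  ultimately have E: "?E = ereal (Lp_norm M \<infinity> f)"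
    by (cases ?E) (auto simp: Lp_norm_def)
  show "AE x in M. cmod (f x) \<le> Lp_norm M \<infinity> f"
    using esssup_AE[where M = M and f = ?u] unfolding E by simp
  show "Lp_norm M \<infinity> f \<le> c" if "AE x in M. cmod (f x) \<le> c"
    using le[OF that] unfolding E by simp
qed

section \<open>Norms of the Taylor majorant\<close>

lemma bdd_measurable_continuous_sphere:
  fixes g :: "real ^ 'd \<Rightarrow> real"
  assumes "continuous_on (sphere 0 1) g"
  shows "bdd_measurable sphere_measure g"
proof -
  have "bounded (g ` sphere 0 1)"
    using assms by (intro compact_imp_bounded compact_continuous_image compact_sphere)
  then show ?thesis
    using borel_measurable_sphere_measure[OF assms]
    by (auto simp: bdd_measurable_def bounded_iff space_sphere_measure)
qed

lemma power_mean_sphere_orthogonal: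
  fixes T :: "real ^ 'd \<Rightarrow> real ^ 'd" and g :: "real ^ 'd \<Rightarrow> real"
  assumes "orthogonal_transformation T" "continuous_on (sphere 0 1) g" "0 < p"
  shows "power_mean sphere_measure p (\<lambda>x. g (T x)) = power_mean sphere_measure p g"
proof -
  have "continuous_on (sphere 0 1) (\<lambda>x. \<bar>g x\<bar> powr p)"
    using assms(2,3) by (intro continuous_on_powr' continuous_intros) auto
  then show ?thesis
    using integral_sphere_measure_orthogonal[OF assms(1), of "\<lambda>x. \<bar>g x\<bar> powr p"]
    by (simp add: power_mean_def)
qed

lemma power_mean_plane_deriv:
  fixes f :: "real ^ 'd \<Rightarrow> complex"
  assumes f: "circle_trig n f" and r: "r \<in> coord_planes" and p: "1 \<le> p"
  shows "power_mean sphere_measure p (\<lambda>x. cmod (plane_deriv n r f x))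
    \<le> real n * power_mean sphere_measure p (\<lambda>x. cmod (f x))"
proof -
  let ?L = "power_mean (sphere_measure :: (real ^ 'd) measure) p"
  let ?R = "\<lambda>k. plane_rot r (riesz_node n k)"
  have bm: "bdd_measurable sphere_measure (\<lambda>x. cmod (g x))" if "circle_trig n g" for g :: "real ^ 'd \<Rightarrow> complex"
    using that by (intro bdd_measurable_continuous_sphere continuous_on_norm circle_trig_continuous_on)
  have bmR: "bdd_measurable sphere_measure (\<lambda>x. cmod (f (?R k x)))" for k
    by (intro bm circle_trig_linear[OF f] linear_plane_rot)
  have "?L (\<lambda>x. cmod (plane_deriv n r f x)) \<le>
      ?L (\<lambda>x. \<Sum>k = 1..<4 * n. cmod (riesz_coeff n k) * cmod (f (?R k x)))"
  proof (rule power_mean_mono)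
    show "bdd_measurable sphere_measure (\<lambda>x. \<Sum>k = 1..<4 * n. cmod (riesz_coeff n k) * cmod (f (?R k x)))"
      by (intro bdd_measurable_sum bdd_measurable_cmult bmR)
    have "cmod (plane_deriv n r f x) \<le> (\<Sum>k = 1..<4 * n. cmod (riesz_coeff n k) * cmod (f (?R k x)))" for x
      unfolding plane_deriv_def by (rule sum_norm_le) (simp add: norm_mult)
    then show "AE x in sphere_measure. \<bar>cmod (plane_deriv n r f x)\<bar> \<le>
        \<bar>\<Sum>k = 1..<4 * n. cmod (riesz_coeff n k) * cmod (f (?R k x))\<bar>"
      by (auto intro: order_trans[OF _ abs_ge_self])
  qed (use p in \<open>simp_all add: finite_measure_sphere_measure bm circle_trig_plane_deriv[OF f]\<close>)
  also have "\<dots> \<le> (\<Sum>k = 1..<4 * n. ?L (\<lambda>x. cmod (riesz_coeff n k) * cmod (f (?R k x))))"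
    using p by (intro power_mean_sum finite_measure_sphere_measure bdd_measurable_cmult bmR)
  also have "\<dots> = (\<Sum>k = 1..<4 * n. cmod (riesz_coeff n k) * ?L (\<lambda>x. cmod (f x)))"
  proof (rule sum.cong[OF refl])
    fix k
    have "?L (\<lambda>x. cmod (f (?R k x))) = ?L (\<lambda>x. cmod (f x))"
      using p power_mean_sphere_orthogonal[OF orthogonal_transformation_plane_rot[OF r], of "\<lambda>x. cmod (f x)" p]
        continuous_on_norm[OF circle_trig_continuous_on[OF f]] by auto
    then show "?L (\<lambda>x. cmod (riesz_coeff n k) * cmod (f (?R k x))) = cmod (riesz_coeff n k) * ?L (\<lambda>x. cmod (f x))"
      using p by (subst power_mean_cmult) auto
  qed
  also have "\<dots> = real n * ?L (\<lambda>x. cmod (f x))"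
    by (simp only: sum_distrib_right[symmetric] sum_norm_riesz_coeff)
  finally show ?thesis .
qed

lemma bdd_measurable_deriv_sum:
  "circle_trig n f \<Longrightarrow> bdd_measurable sphere_measure (deriv_sum n m f)"
  by (intro bdd_measurable_continuous_sphere continuous_on_deriv_sum)

lemma power_mean_deriv_sum:
  fixes f :: "real ^ 'd \<Rightarrow> complex"
  assumes "circle_trig n f" "1 \<le> p"
  shows "power_mean sphere_measure p (deriv_sum n m f) \<le>
    (real (card (coord_planes :: ('d \<times> 'd) set)) * real n) ^ m * power_mean sphere_measure p (\<lambda>x. cmod (f x))"
  using assms(1)
proof (induction m arbitrary: f)
  case 0
  then show ?case by (simp add: deriv_sum.simps(1)[abs_def])
next
  case (Suc m)
  let ?L = "power_mean (sphere_measure :: (real ^ 'd) measure) p"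
  let ?I = "coord_planes :: ('d \<times> 'd) set"
  let ?c = "(real (card ?I) * real n) ^ m"
  have "?L (deriv_sum n (Suc m) f) = ?L (\<lambda>x. \<Sum>r\<in>?I. deriv_sum n m (plane_deriv n r f) x)"
    by (simp only: deriv_sum.simps(2)[abs_def])
  also have "\<dots> \<le> (\<Sum>r\<in>?I. ?L (deriv_sum n m (plane_deriv n r f)))"
    using Suc.prems assms(2)
    by (intro power_mean_sum finite_measure_sphere_measure bdd_measurable_deriv_sum circle_trig_plane_deriv)
  also have "\<dots> \<le> (\<Sum>r\<in>?I. ?c * (real n * ?L (\<lambda>x. cmod (f x))))"
  proof (rule sum_mono)
    fix r assume r: "r \<in> ?I"
    have "?L (deriv_sum n m (plane_deriv n r f)) \<le> ?c * ?L (\<lambda>x. cmod (plane_deriv n r f x))"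
      using Suc.prems by (intro Suc.IH circle_trig_plane_deriv)
    also have "\<dots> \<le> ?c * (real n * ?L (\<lambda>x. cmod (f x)))"
      using Suc.prems assms(2) r by (intro mult_left_mono power_mean_plane_deriv) auto
    finally show "?L (deriv_sum n m (plane_deriv n r f)) \<le> ?c * (real n * ?L (\<lambda>x. cmod (f x)))" .
  qed
  also have "\<dots> = (real (card ?I) * real n) ^ Suc m * ?L (\<lambda>x. cmod (f x))"
    by simp
  finally show ?case .
qed

text \<open>The bound \<open>exp y - 1 \<le> 2 y\<close> is uniform in \<open>M\<close>, and it is
  the origin of the factor 2 in the smallness condition on the partition norm.\<close>

lemma exp_partial_sum_bound:
  fixes y :: real
  assumes "0 \<le> y" "y \<le> 1 / 2"
  shows "(\<Sum>m<M. y ^ Suc m / fact (Suc m)) \<le> 2 * y"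
proof -
  have "1 + (\<Sum>m<M. y ^ Suc m / fact (Suc m)) = (\<Sum>m<Suc M. y ^ m /\<^sub>R fact m)"
    by (subst sum.lessThan_Suc_shift) (simp add: divide_inverse mult.commute)
  also have "\<dots> \<le> exp y"
    unfolding exp_def using assms(1) by (intro sum_le_suminf summable_exp_generic) auto
  also have "\<dots> \<le> 1 + 2 * y"
    using assms by (rule real_exp_bound_lemma)
  finally show ?thesis by simp
qed

lemma bdd_measurable_taylor_bound:
  "circle_trig n f \<Longrightarrow> bdd_measurable sphere_measure (\<lambda>x. taylor_bound n M f x C h)"
  unfolding taylor_bound_def
  by (intro bdd_measurable_add bdd_measurable_sum bdd_measurable_cmult bdd_measurable_deriv_sum
      bdd_measurable_const)

text \<open>By Bernstein's inequality, order \<open>m\<close> contributes at most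
  \<open>h^m / m! (K n)^m = y^m / m!\<close> times the norm of \<open>f\<close>.\<close>

lemma power_mean_taylor_bound:
  fixes f :: "real ^ 'd \<Rightarrow> complex" and h :: real and n :: nat
  defines "y \<equiv> h * (real (card (coord_planes :: ('d \<times> 'd) set)) * real n)"
  assumes f: "circle_trig n f" and p: "1 \<le> p" and h: "0 \<le> h" and y: "y \<le> 1 / 2" and C: "0 \<le> C"
  shows "power_mean sphere_measure p (\<lambda>x. taylor_bound n M f x C h) \<le>
    2 * y * power_mean sphere_measure p (\<lambda>x. cmod (f x)) +
    y ^ Suc M / fact (Suc M) * (C * power_mean (sphere_measure :: (real ^ 'd) measure) p (\<lambda>_. 1))"
proof -
  let ?L = "power_mean (sphere_measure :: (real ^ 'd) measure) p"
  let ?K = "real (card (coord_planes :: ('d \<times> 'd) set)) * real n"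
  let ?N = "?L (\<lambda>x. cmod (f x))"
  define R where "R = h ^ Suc M / fact (Suc M) * (?K ^ Suc M * C)"
  have y0: "0 \<le> y"
    using h by (simp add: y_def)
  have "?L (\<lambda>x. taylor_bound n M f x C h) \<le>
      ?L (\<lambda>x. \<Sum>m<M. h ^ Suc m / fact (Suc m) * deriv_sum n (Suc m) f x) + ?L (\<lambda>x. R * 1)"
    unfolding taylor_bound_def R_def mult_1_right using p
    by (intro power_mean_triangle finite_measure_sphere_measure bdd_measurable_sum bdd_measurable_cmult
        bdd_measurable_deriv_sum bdd_measurable_const f)
  also have "?L (\<lambda>x. \<Sum>m<M. h ^ Suc m / fact (Suc m) * deriv_sum n (Suc m) f x) \<le>
      (\<Sum>m<M. ?L (\<lambda>x. h ^ Suc m / fact (Suc m) * deriv_sum n (Suc m) f x))"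
    using p by (intro power_mean_sum finite_measure_sphere_measure bdd_measurable_cmult
        bdd_measurable_deriv_sum f)
  also have "\<dots> \<le> (\<Sum>m<M. y ^ Suc m / fact (Suc m) * ?N)"
  proof (rule sum_mono)
    fix m
    have "?L (\<lambda>x. h ^ Suc m / fact (Suc m) * deriv_sum n (Suc m) f x) =
        \<bar>h ^ Suc m / fact (Suc m)\<bar> * ?L (deriv_sum n (Suc m) f)"
      using p by (intro power_mean_cmult) simp
    also have "\<dots> \<le> h ^ Suc m / fact (Suc m) * (?K ^ Suc m * ?N)"
      using h f p by (simp only: abs_of_nonneg zero_le_power zero_le_divide_iff fact_ge_zero simp_thms)
        (intro mult_left_mono power_mean_deriv_sum, auto)
    also have "\<dots> = y ^ Suc m / fact (Suc m) * ?N"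
      by (simp only: y_def power_mult_distrib times_divide_eq_left mult.assoc)
    finally show "?L (\<lambda>x. h ^ Suc m / fact (Suc m) * deriv_sum n (Suc m) f x) \<le> y ^ Suc m / fact (Suc m) * ?N" .
  qed
  also have "\<dots> \<le> 2 * y * ?N"
    using exp_partial_sum_bound[OF y0 y, of M]
    by (simp only: sum_distrib_right[symmetric]) (intro mult_right_mono power_mean_nonneg)
  also have "?L (\<lambda>x. R * 1) = \<bar>R\<bar> * ?L (\<lambda>_. 1)"
    using p by (intro power_mean_cmult) simp
  also have "\<bar>R\<bar> = y ^ Suc M / fact (Suc M) * C"
  proof -
    have "R = y ^ Suc M / fact (Suc M) * C"
      by (simp only: R_def y_def power_mult_distrib times_divide_eq_left mult.assoc)
    moreover have "0 \<le> y ^ Suc M / fact (Suc M) * C"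
      using y0 C by (intro mult_nonneg_nonneg divide_nonneg_nonneg) auto
    ultimately show ?thesis by (simp only: abs_of_nonneg)
  qed
  finally show ?thesis by (simp only: mult.assoc)
qed

lemma taylor_bound_mono:
  assumes "0 \<le> t" "t \<le> h" "0 \<le> C"
  shows "taylor_bound n M f x C t \<le> taylor_bound n M f x C h"
  unfolding taylor_bound_def using assms
  by (intro add_mono sum_mono mult_right_mono divide_right_mono power_mono mult_nonneg_nonneg
      zero_le_power deriv_sum_nonneg) auto

lemma taylor_bound_nonneg:
  assumes "0 \<le> t" "0 \<le> C"
  shows "0 \<le> taylor_bound n M f x C t"
  unfolding taylor_bound_def using assms
  by (intro add_nonneg_nonneg sum_nonneg mult_nonneg_nonneg divide_nonneg_nonneg zero_le_power
      deriv_sum_nonneg) auto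

lemma geodesic_taylor_bound:
  fixes f :: "real ^ 'd \<Rightarrow> complex"
  assumes f: "circle_trig n f" and C: "\<And>y. y \<in> sphere 0 1 \<Longrightarrow> cmod (f y) \<le> C"
    and x: "x \<in> sphere 0 1" and \<xi>: "\<xi> \<in> sphere 0 1"
    and h: "geodesic_dist x \<xi> \<le> h" "h < pi"
  shows "cmod (f \<xi> - f x) \<le> taylor_bound n M f x C h"
proof -
  define \<theta> where "\<theta> = geodesic_dist x \<xi>"
  have C0: "0 \<le> C"
    using C[OF x] norm_ge_zero order_trans by blast
  have nx: "norm x = 1" and n\<xi>: "norm \<xi> = 1"
    using x \<xi> by auto
  have sq: "x \<bullet> x = 1" "\<xi> \<bullet> \<xi> = 1"
    using nx n\<xi> by (simp_all add: norm_eq_1)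
  have cs: "\<bar>x \<bullet> \<xi>\<bar> \<le> 1"
    using Cauchy_Schwarz_ineq2[of x \<xi>] nx n\<xi> by simp
  then have \<theta>: "0 \<le> \<theta>" "cos \<theta> = x \<bullet> \<xi>"
    by (auto simp: \<theta>_def geodesic_dist_def intro: arccos_lbound)
  have \<theta>h: "\<theta> \<le> h" "0 \<le> h"
    using h \<theta> by (simp_all add: \<theta>_def)
  show ?thesis
  proof (cases "\<theta> = 0")
    case True
    then have "x \<bullet> \<xi> = 1" using \<theta> by simp
    then have "(\<xi> - x) \<bullet> (\<xi> - x) = 0"
      by (simp add: inner_diff_left inner_diff_right sq inner_commute)
    then have "\<xi> = x" by simp
    then show ?thesis using taylor_bound_nonneg[OF \<theta>h(2) C0] by simp
  next
    case False
    then have s: "0 < sin \<theta>"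
      using \<theta> \<theta>h h by (intro sin_gt_zero) auto
    \<comment> \<open>The unit tangent at \<open>x\<close> pointing to \<open>\<xi>\<close>; the
      sine is positive because \<open>0 < \<theta> < pi\<close>. The case
      \<open>\<theta> = 0\<close>, which has no direction, is the case
      \<open>\<xi> = x\<close>.\<close>
    define e where "e = (\<xi> - cos \<theta> *\<^sub>R x) /\<^sub>R sin \<theta>"
    have xe: "x \<bullet> e = 0"
      by (simp add: e_def inner_diff_right sq \<theta>)
    have "(\<xi> - cos \<theta> *\<^sub>R x) \<bullet> (\<xi> - cos \<theta> *\<^sub>R x) = 1 - (cos \<theta>)\<^sup>2"
      by (simp add: inner_diff_left inner_diff_right sq \<theta>(2) inner_commute[of \<xi> x] power2_eq_square)
    also have "\<dots> = (sin \<theta>)\<^sup>2"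
      by (simp add: sin_squared_eq)
    finally have "(norm (\<xi> - cos \<theta> *\<^sub>R x))\<^sup>2 = (sin \<theta>)\<^sup>2"
      by (simp add: dot_square_norm)
    then have "norm (\<xi> - cos \<theta> *\<^sub>R x) = sin \<theta>"
      using s by (simp add: power2_eq_iff_nonneg)
    then have ne: "norm e = 1"
      using s by (simp add: e_def)
    have "\<xi> = cos \<theta> *\<^sub>R x + sin \<theta> *\<^sub>R e"
      using s by (simp add: e_def)
    then have "cmod (f \<xi> - f x) \<le> taylor_bound n M f x C \<theta>"
      using taylor_bound[OF f C \<theta>(1) nx ne xe, of M] by simp
    also have "\<dots> \<le> taylor_bound n M f x C h"
      using \<theta> \<theta>h C0 by (intro taylor_bound_mono)
    finally show ?thesis .
  qed
qed

section \<open>Discretization\<close>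

lemma card_coord_planes_le:
  assumes "CARD('d) = q + 1"
  shows "real (card (coord_planes :: ('d::finite \<times> 'd) set)) \<le> (real q + 1)\<^sup>2"
proof -
  have "card (coord_planes :: ('d \<times> 'd) set) \<le> CARD('d \<times> 'd)"
    by (rule card_mono) auto
  also have "\<dots> = (q + 1)\<^sup>2"
    using assms by (simp add: power2_eq_square)
  finally have "real (card (coord_planes :: ('d \<times> 'd) set)) \<le> real ((q + 1)\<^sup>2)"
    by (simp only: of_nat_le_iff)
  then show ?thesis by (simp add: add.commute)
qed

lemma circle_trig_bounded:
  assumes "circle_trig n f"
  shows "\<exists>C\<ge>0. \<forall>x\<in>sphere 0 1. cmod (f x) \<le> C"
proof -
  have "bounded (f ` sphere 0 1)"
    using circle_trig_continuous_on[OF assms]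
    by (intro compact_imp_bounded compact_continuous_image compact_sphere)
  then obtain C where "0 < C" "\<forall>y\<in>f ` sphere 0 1. cmod y \<le> C"
    unfolding bounded_pos by blast
  then show ?thesis
    by (intro exI[of _ C]) auto
qed

text \<open>As \<open>3 \<ge> exp 1\<close>, the power \<open>3 powr (q / 2)\<close> dominates the
  quadratic Taylor polynomial of the exponential at \<open>q / 2\<close>; with \<open>pi > 3\<close>
  this exceeds the number of coordinate planes.\<close>

lemma C_const_bound: "2 * (real q + 1)\<^sup>2 \<le> 5 * C_const q"
proof -
  have "exp (real q / 2) = exp 1 powr (real q / 2)"
    by (simp add: powr_def)
  also have "\<dots> \<le> 3 powr (real q / 2)"
    using exp_le by (intro powr_mono2) auto
  finally have "1 + real q / 2 + (real q / 2)\<^sup>2 / 2 \<le> 3 powr (real q / 2)"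
    using exp_lower_Taylor_quadratic[of "real q / 2"] by simp
  then have "(1 + real q / 2 + (real q / 2)\<^sup>2 / 2) * 3 \<le> 3 powr (real q / 2) * pi"
    using pi_gt3 by (intro mult_mono) auto
  then have "30 + 15 * real q + 15 / 4 * (real q)\<^sup>2 \<le> 10 * (3 powr (real q / 2) * pi)"
    by (simp add: power2_eq_square algebra_simps)
  moreover have "2 * (real q + 1)\<^sup>2 = 2 * (real q)\<^sup>2 + 4 * real q + 2"
    by (simp add: power2_eq_square algebra_simps)
  moreover have "5 * C_const q = 30 + 10 * (3 powr (real q / 2) * pi)"
    by (simp add: C_const_def)
  ultimately show ?thesis
    using zero_le_power2[of "real q"] of_nat_0_le_iff[of q] by linarith
qed

text \<open>Nodes are indexed by patches, inversely to \<open>patch_of\<close>, so that sums over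
  nodes can be rewritten as sums over patches.\<close>

definition patch_nodes :: "(real ^ 'd) set \<Rightarrow> (real ^ 'd) set set \<Rightarrow> ((real ^ 'd) set \<Rightarrow> real ^ 'd) \<Rightarrow> bool" where
  "patch_nodes \<Xi> \<Z> z \<longleftrightarrow> bij_betw z \<Z> \<Xi> \<and>
     (\<forall>Z\<in>\<Z>. z Z \<in> Z \<and> z Z \<in> sphere_interior Z \<and> patch_of \<Z> (z Z) = Z)"

lemma patch_nodesD:
  assumes "patch_nodes \<Xi> \<Z> z"
  shows "bij_betw z \<Z> \<Xi>" "Z \<in> \<Z> \<Longrightarrow> z Z \<in> Z" "Z \<in> \<Z> \<Longrightarrow> z Z \<in> sphere_interior Z"
    "Z \<in> \<Z> \<Longrightarrow> patch_of \<Z> (z Z) = Z" "Z \<in> \<Z> \<Longrightarrow> z Z \<in> \<Xi>"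
  using assms by (auto simp: patch_nodes_def bij_betw_def)

lemma compatible_pair_patch_nodes:
  assumes cp: "compatible_pair \<Xi> \<Z>"
  shows "\<exists>z. patch_nodes \<Xi> \<Z> z"
proof -
  have "\<forall>Z\<in>\<Z>. \<exists>\<xi>. \<Xi> \<inter> sphere_interior Z = {\<xi>} \<and> \<Xi> \<inter> Z = {\<xi>}"
    using cp by (simp add: compatible_pair_def)
  then obtain z where z: "\<And>Z. Z \<in> \<Z> \<Longrightarrow> \<Xi> \<inter> sphere_interior Z = {z Z}"
    "\<And>Z. Z \<in> \<Z> \<Longrightarrow> \<Xi> \<inter> Z = {z Z}"
    by metis
  have zin: "z Z \<in> \<Xi>" "z Z \<in> Z" "z Z \<in> sphere_interior Z" if "Z \<in> \<Z>" for Z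
    using z[OF that] by blast+
  have uniq: "Z = Z'" if "Z \<in> \<Z>" "Z' \<in> \<Z>" "\<xi> \<in> \<Xi>" "\<xi> \<in> Z" "\<xi> \<in> Z'" for Z Z' \<xi>
    using ex1_patch[OF cp that(3)] that by blast
  have patch: "patch_of \<Z> (z Z) = Z" if "Z \<in> \<Z>" for Z
    unfolding patch_of_def using that zin uniq by (intro the_equality) blast+
  have "bij_betw z \<Z> \<Xi>"
  proof (rule bij_betw_imageI)
    show "inj_on z \<Z>"
      using patch by (metis inj_onI)
    have "\<xi> \<in> z ` \<Z>" if \<xi>: "\<xi> \<in> \<Xi>" for \<xi>
    proof -
      obtain Z where "Z \<in> \<Z>" "\<xi> \<in> Z"
        using ex1_patch[OF cp \<xi>] by blast
      then show ?thesis using z(2) \<xi> by blast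
    qed
    then show "z ` \<Z> = \<Xi>"
      using zin(1) by blast
  qed
  then have "patch_nodes \<Xi> \<Z> z"
    using zin patch by (simp add: patch_nodes_def)
  then show ?thesis by blast
qed

lemma integral_discretized_measure:
  fixes \<phi> :: "real ^ 'd \<Rightarrow> real"
  assumes "finite \<Xi>" "\<Xi> \<subseteq> sphere 0 1" "\<phi> \<in> borel_measurable sphere_measure"
  shows "(\<integral>x. \<phi> x \<partial>discretized_measure \<Xi> \<Z>) = (\<Sum>\<xi>\<in>\<Xi>. measure sphere_measure (patch_of \<Z> \<xi>) * \<phi> \<xi>)"
proof -
  interpret finite_measure "sphere_measure :: (real ^ 'd) measure"
    by (rule finite_measure_sphere_measure)
  have "(\<integral>x. \<phi> x \<partial>discretized_measure \<Xi> \<Z>) =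
      (\<integral>x. \<phi> x \<partial>point_measure \<Xi> (\<lambda>\<xi>. emeasure sphere_measure (patch_of \<Z> \<xi>)))"
    unfolding discretized_measure_def using assms
    by (intro integral_distr) (auto simp: space_sphere_measure)
  also have "\<dots> = (\<Sum>\<xi>\<in>\<Xi>. measure sphere_measure (patch_of \<Z> \<xi>) *\<^sub>R \<phi> \<xi>)"
    unfolding emeasure_eq_measure using assms(1) by (intro lebesgue_integral_point_measure_finite) auto
  finally show ?thesis by simp
qed

text \<open>Lets the Taylor order tend to infinity, which removes the sup norm from the final
  estimate.\<close>

lemma le_of_power_fact_error:
  fixes a b c y :: real
  assumes "\<And>M. a \<le> b + y ^ Suc M / fact (Suc M) * c"
  shows "a \<le> b"
proof -
  have "(\<lambda>M. y ^ M / fact M) \<longlonglongrightarrow> 0"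
    using summable_LIMSEQ_zero[OF summable_exp[of y]] by (simp add: divide_inverse mult.commute)
  then have "(\<lambda>M. b + y ^ Suc M / fact (Suc M) * c) \<longlonglongrightarrow> b + 0 * c"
    by (intro tendsto_intros LIMSEQ_Suc)
  then show ?thesis
    using assms by (intro LIMSEQ_le_const[of _ b]) auto
qed

lemma sphere_partitionD:
  assumes "sphere_partition \<Z>"
  shows "finite \<Z>" "\<Z> \<subseteq> sets sphere_measure" "\<Union>\<Z> = sphere 0 1"
    "\<And>Z Z'. Z \<in> \<Z> \<Longrightarrow> Z' \<in> \<Z> \<Longrightarrow> Z \<noteq> Z' \<Longrightarrow> emeasure sphere_measure (Z \<inter> Z') = 0"
  using assms by (simp_all add: sphere_partition_def)

text \<open>The exceptional points lie in finitely many pairwise overlaps, each a null set.\<close>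

lemma sphere_partition_AE_unique:
  fixes \<Z> :: "(real ^ 'd) set set"
  assumes "sphere_partition \<Z>"
  shows "AE x in sphere_measure. \<exists>Z\<in>\<Z>. x \<in> Z \<and> (\<forall>Z'\<in>\<Z>. x \<in> Z' \<longrightarrow> Z' = Z)"
proof -
  note fin = sphere_partitionD(1)[OF assms] and sub = sphere_partitionD(2)[OF assms]
    and un = sphere_partitionD(3)[OF assms] and null = sphere_partitionD(4)[OF assms]
  have "AE x in sphere_measure. \<forall>Z\<in>\<Z>. \<forall>Z'\<in>\<Z>. Z \<noteq> Z' \<longrightarrow> x \<notin> Z \<inter> Z'"
  proof (intro AE_finite_allI fin)
    fix Z Z' assume Z: "Z \<in> \<Z>" "Z' \<in> \<Z>"
    show "AE x in sphere_measure. Z \<noteq> Z' \<longrightarrow> x \<notin> Z \<inter> Z'"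
    proof (cases "Z = Z'")
      case False
      then have "Z \<inter> Z' \<in> null_sets sphere_measure"
        using null[OF Z] subsetD[OF sub Z(1)] subsetD[OF sub Z(2)] by (intro null_setsI sets.Int)
      then have "AE x in sphere_measure. x \<notin> Z \<inter> Z'"
        by (rule AE_not_in)
      then show ?thesis
        by (rule AE_mp) simp
    qed simp
  qed
  then show ?thesis
  proof (rule AE_mp, intro AE_I2 impI)
    fix x :: "real ^ 'd"
    assume sp: "x \<in> space sphere_measure" and x: "\<forall>Z\<in>\<Z>. \<forall>Z'\<in>\<Z>. Z \<noteq> Z' \<longrightarrow> x \<notin> Z \<inter> Z'"
    have "x \<in> \<Union>\<Z>"
      using sp by (simp only: un space_sphere_measure)
    then obtain Z where Z: "Z \<in> \<Z>" "x \<in> Z" by (rule UnionE)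
    have "Z' = Z" if Z': "Z' \<in> \<Z>" "x \<in> Z'" for Z'
    proof (rule ccontr)
      assume "Z' \<noteq> Z"
      then have "x \<notin> Z' \<inter> Z"
        using bspec[OF bspec[OF x Z'(1)] Z(1)] by simp
      then show False
        using Z(2) Z'(2) by simp
    qed
    with Z show "\<exists>Z\<in>\<Z>. x \<in> Z \<and> (\<forall>Z'\<in>\<Z>. x \<in> Z' \<longrightarrow> Z' = Z)" by blast
  qed
qed

text \<open>Replacing \<open>cmod \<circ> f\<close> by its value at the node of each patch gives a step function whose
  \<open>L\<^sup>p\<close> norm is the discretized norm of \<open>f\<close>.\<close>

lemma discretized_power_mean:
  fixes f :: "real ^ 'd \<Rightarrow> complex" and \<Z> :: "(real ^ 'd) set set"
  defines "s \<equiv> \<lambda>z x. \<Sum>Z\<in>\<Z>. indicator Z x * cmod (f (z Z))"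
  assumes cp: "compatible_pair \<Xi> \<Z>" and f: "continuous_on (sphere 0 1) f" and p: "1 \<le> p"
    and nodes: "patch_nodes \<Xi> \<Z> z"
  shows "bdd_measurable sphere_measure (s z)"
    and "AE x in sphere_measure. \<exists>Z\<in>\<Z>. x \<in> Z \<and> s z x = cmod (f (z Z))"
    and "power_mean (discretized_measure \<Xi> \<Z>) p (\<lambda>x. cmod (f x)) = power_mean sphere_measure p (s z)"
proof -
  interpret finite_measure "sphere_measure :: (real ^ 'd) measure"
    by (rule finite_measure_sphere_measure)
  have part: "sphere_partition \<Z>" and \<Xi>: "finite \<Xi>" "\<Xi> \<subseteq> sphere 0 1"
    using cp by (simp_all add: compatible_pair_def)
  note fin = sphere_partitionD(1)[OF part] and sub = sphere_partitionD(2)[OF part]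
  from sub have sets: "Z \<in> sets sphere_measure" if "Z \<in> \<Z>" for Z
    using that by (rule subsetD)
  have pick: "(\<Sum>Z'\<in>\<Z>. indicator Z' x * F Z') = (F Z :: real)"
    if "Z \<in> \<Z>" "x \<in> Z" "\<forall>Z'\<in>\<Z>. x \<in> Z' \<longrightarrow> Z' = Z" for x Z F
  proof -
    have "(\<Sum>Z'\<in>\<Z>. indicator Z' x * F Z') = (\<Sum>Z'\<in>\<Z>. if Z' = Z then F Z else 0)"
    proof (rule sum.cong[OF refl])
      fix Z' assume "Z' \<in> \<Z>"
      then have "x \<in> Z' \<longleftrightarrow> Z' = Z"
        using bspec[OF that(3)] that(2) by blast
      then show "indicator Z' x * F Z' = (if Z' = Z then F Z else 0)"
        by (cases "Z' = Z") simp_all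
    qed
    then show ?thesis using fin that(1) by simp
  qed
  have "bdd_measurable sphere_measure (\<lambda>x. indicator Z x * c)" if "Z \<in> \<Z>" for Z c
  proof -
    have "bdd_measurable sphere_measure (indicator Z)"
      unfolding bdd_measurable_def
      using borel_measurable_indicator[OF sets[OF that]] by (intro conjI exI[of _ 1]) simp_all
    then have "bdd_measurable sphere_measure (\<lambda>x. c * indicator Z x)"
      by (rule bdd_measurable_cmult)
    then show ?thesis
      by (simp only: mult.commute)
  qed
  then show s: "bdd_measurable sphere_measure (s z)"
    unfolding s_def by (rule bdd_measurable_sum)
  show "AE x in sphere_measure. \<exists>Z\<in>\<Z>. x \<in> Z \<and> s z x = cmod (f (z Z))"
    using sphere_partition_AE_unique[OF part]
  proof (rule AE_mp, intro AE_I2 impI)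
    fix x :: "real ^ 'd"
    assume "\<exists>Z\<in>\<Z>. x \<in> Z \<and> (\<forall>Z'\<in>\<Z>. x \<in> Z' \<longrightarrow> Z' = Z)"
    then obtain Z where Z: "Z \<in> \<Z>" "x \<in> Z" "\<forall>Z'\<in>\<Z>. x \<in> Z' \<longrightarrow> Z' = Z" by blast
    have "s z x = cmod (f (z Z))"
      unfolding s_def by (rule pick[OF Z])
    with Z(1,2) show "\<exists>Z\<in>\<Z>. x \<in> Z \<and> s z x = cmod (f (z Z))" by blast
  qed
  have fp: "continuous_on (sphere 0 1) (\<lambda>x. \<bar>cmod (f x)\<bar> powr p)"
    using f p by (intro continuous_on_powr' continuous_intros) auto
  let ?G = "\<lambda>Z. cmod (f (z Z)) powr p"
  have G: "(\<lambda>x. \<Sum>Z\<in>\<Z>. indicator Z x * ?G Z) \<in> borel_measurable sphere_measure"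
    by (intro borel_measurable_sum borel_measurable_times borel_measurable_indicator
        borel_measurable_const sets)
  have "(\<integral>x. \<bar>cmod (f x)\<bar> powr p \<partial>discretized_measure \<Xi> \<Z>) =
      (\<Sum>\<xi>\<in>\<Xi>. measure sphere_measure (patch_of \<Z> \<xi>) * cmod (f \<xi>) powr p)"
    using integral_discretized_measure[OF \<Xi> borel_measurable_sphere_measure[OF fp]] by simp
  also have "\<dots> = (\<Sum>Z\<in>\<Z>. measure sphere_measure Z * ?G Z)"
    by (subst sum.reindex_bij_betw[OF patch_nodesD(1)[OF nodes], symmetric])
       (simp add: patch_nodesD(4)[OF nodes])
  also have "\<dots> = (\<integral>x. (\<Sum>Z\<in>\<Z>. indicator Z x * ?G Z) \<partial>sphere_measure)"
  proof -
    have "integrable sphere_measure (\<lambda>x. indicator Z x * ?G Z)" if "Z \<in> \<Z>" for Z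
      using sets[OF that] emeasure_finite[of Z]
      by (intro integrable_mult_left integrable_real_indicator) (simp_all add: less_top[symmetric])
    then have "(\<integral>x. (\<Sum>Z\<in>\<Z>. indicator Z x * ?G Z) \<partial>sphere_measure) =
        (\<Sum>Z\<in>\<Z>. \<integral>x. indicator Z x * ?G Z \<partial>sphere_measure)"
      by (rule Bochner_Integration.integral_sum)
    also have "\<dots> = (\<Sum>Z\<in>\<Z>. measure sphere_measure Z * ?G Z)"
      using sets by (intro sum.cong refl) simp
    finally show ?thesis ..
  qed
  \<comment> \<open>The power of the step function is the step function of the powers at points of
    exactly one patch, hence almost everywhere.\<close>
  also have "\<dots> = (\<integral>x. \<bar>s z x\<bar> powr p \<partial>sphere_measure)"
  proof (rule integral_cong_AE[OF G])
    have [measurable]: "s z \<in> borel_measurable sphere_measure"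
      using s by (simp add: bdd_measurable_def)
    show "(\<lambda>x. \<bar>s z x\<bar> powr p) \<in> borel_measurable sphere_measure"
      by measurable
    show "AE x in sphere_measure. (\<Sum>Z\<in>\<Z>. indicator Z x * ?G Z) = \<bar>s z x\<bar> powr p"
      using sphere_partition_AE_unique[OF part]
    proof (rule AE_mp, intro AE_I2 impI)
      fix x :: "real ^ 'd"
      assume "\<exists>Z\<in>\<Z>. x \<in> Z \<and> (\<forall>Z'\<in>\<Z>. x \<in> Z' \<longrightarrow> Z' = Z)"
      then obtain Z where Z: "Z \<in> \<Z>" "x \<in> Z" "\<forall>Z'\<in>\<Z>. x \<in> Z' \<longrightarrow> Z' = Z" by blast
      show "(\<Sum>Z\<in>\<Z>. indicator Z x * ?G Z) = \<bar>s z x\<bar> powr p"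
        unfolding s_def pick[OF Z] by simp
    qed
  qed
  finally show "power_mean (discretized_measure \<Xi> \<Z>) p (\<lambda>x. cmod (f x)) = power_mean sphere_measure p (s z)"
    by (simp add: power_mean_def)
qed

text \<open>Distances never exceed \<open>pi\<close>, so the supremum is over a bounded set and is
  indeed an upper bound.\<close>

lemma geodesic_dist_le_partition_norm:
  assumes "sphere_partition \<Z>" "Z \<in> \<Z>" "x \<in> Z" "y \<in> Z"
  shows "geodesic_dist x y \<le> partition_norm \<Z>"
proof -
  have "geodesic_dist x y \<le> pi" if "Z \<in> \<Z>" "x \<in> Z" "y \<in> Z" for x y Z
  proof -
    have "norm x = 1" "norm y = 1"
      using sphere_partitionD(3)[OF assms(1)] that by auto
    then have "\<bar>x \<bullet> y\<bar> \<le> 1"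
      using Cauchy_Schwarz_ineq2[of x y] by simp
    then show ?thesis
      unfolding geodesic_dist_def by (intro arccos_ubound) auto
  qed
  then have "bdd_above ((\<lambda>(x, y). geodesic_dist x y) ` (\<Union>Z\<in>\<Z>. Z \<times> Z))"
    by (intro bdd_aboveI[of _ pi]) auto
  then show ?thesis
    unfolding partition_norm_def using assms
    by (intro cSUP_upper2[of _ _ "(x, y)"]) auto
qed

lemma discretized_power_mean_bounds:
  fixes f :: "real ^ 'd \<Rightarrow> complex" and \<Z> :: "(real ^ 'd) set set"
  assumes cp: "compatible_pair \<Xi> \<Z>" and f: "circle_trig n f" and p: "1 \<le> p"
    and h: "0 \<le> partition_norm \<Z>" "partition_norm \<Z> < pi"
    and \<eta>: "2 * (partition_norm \<Z> * (real (card (coord_planes :: ('d \<times> 'd) set)) * real n)) \<le> \<eta>" "\<eta> < 1"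
  shows "(1 - \<eta>) * power_mean sphere_measure p (\<lambda>x. cmod (f x)) \<le>
      power_mean (discretized_measure \<Xi> \<Z>) p (\<lambda>x. cmod (f x))"
    and "power_mean (discretized_measure \<Xi> \<Z>) p (\<lambda>x. cmod (f x)) \<le>
      (1 + \<eta>) * power_mean sphere_measure p (\<lambda>x. cmod (f x))"
proof -
  let ?L = "power_mean (sphere_measure :: (real ^ 'd) measure) p"
  let ?h = "partition_norm \<Z>"
  let ?y = "?h * (real (card (coord_planes :: ('d \<times> 'd) set)) * real n)"
  let ?f = "\<lambda>x. cmod (f x)"
  have part: "sphere_partition \<Z>"
    using cp by (simp add: compatible_pair_def)
  obtain z where nodes: "patch_nodes \<Xi> \<Z> z"
    using compatible_pair_patch_nodes[OF cp] by blast
  note z = patch_nodesD[OF nodes]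
  define s where "s x = (\<Sum>Z\<in>\<Z>. indicator Z x * cmod (f (z Z)))" for x
  have s: "bdd_measurable sphere_measure s"
    "AE x in sphere_measure. \<exists>Z\<in>\<Z>. x \<in> Z \<and> s x = cmod (f (z Z))"
    "power_mean (discretized_measure \<Xi> \<Z>) p ?f = ?L s"
    using discretized_power_mean[OF cp circle_trig_continuous_on[OF f] p nodes]
    unfolding s_def[abs_def] by blast+
  have bf: "bdd_measurable sphere_measure ?f"
    by (intro bdd_measurable_continuous_sphere continuous_on_norm circle_trig_continuous_on[OF f])
  obtain C where C: "0 \<le> C" "\<And>x. x \<in> sphere 0 1 \<Longrightarrow> cmod (f x) \<le> C"
    using circle_trig_bounded[OF f] by blast
  let ?G = "\<lambda>M x. taylor_bound n M f x C ?h"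
  have bG: "bdd_measurable sphere_measure (?G M)" for M
    by (rule bdd_measurable_taylor_bound[OF f])
  \<comment> \<open>At almost every \<open>x\<close> the step function takes the modulus of
    \<open>f\<close> at a node within distance \<open>?h\<close>; the majorant does not refer to
    that node and so can be integrated over the whole sphere.\<close>
  have close: "AE x in sphere_measure. \<bar>s x - ?f x\<bar> \<le> ?G M x \<and> 0 \<le> s x" for M
    using s(2)
  proof eventually_elim
    case (elim x)
    then obtain Z where Z: "Z \<in> \<Z>" "x \<in> Z" "s x = cmod (f (z Z))" by blast
    then have "x \<in> sphere 0 1" "z Z \<in> sphere 0 1"
      using sphere_partitionD(3)[OF part] Z(1,2) z(2)[OF Z(1)] by blast+
    moreover have "geodesic_dist x (z Z) \<le> ?h"
      using Z z(2) by (intro geodesic_dist_le_partition_norm[OF part])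
    ultimately have "cmod (f (z Z) - f x) \<le> ?G M x"
      using h C f by (intro geodesic_taylor_bound) auto
    then show ?case
      using norm_triangle_ineq3[of "f (z Z)" "f x"] Z(3) by simp
  qed
  have LG: "?L (?G M) \<le> \<eta> * ?L ?f + ?y ^ Suc M / fact (Suc M) * (C * ?L (\<lambda>_. 1))" for M
  proof -
    have "?L (?G M) \<le> 2 * ?y * ?L ?f + ?y ^ Suc M / fact (Suc M) * (C * ?L (\<lambda>_. 1))"
      \<comment> \<open>The requirement \<open>?y \<le> 1 / 2\<close> follows from
        \<open>2 * ?y \<le> \<eta> < 1\<close>.\<close>
      using h \<eta> C(1) by (intro power_mean_taylor_bound f p) auto
    moreover have "2 * ?y * ?L ?f \<le> \<eta> * ?L ?f"
      using \<eta>(1) by (intro mult_right_mono power_mean_nonneg)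
    ultimately show ?thesis by linarith
  qed
  \<comment> \<open>Proved with an additional remainder for every order \<open>M\<close>, while
    \<open>C\<close> and \<open>f\<close> stay fixed; the second estimate swaps the roles of
    \<open>s\<close> and the modulus of \<open>f\<close>.\<close>
  have "?L ?f \<le> ?L s + \<eta> * ?L ?f"
  proof (rule le_of_power_fact_error)
    fix M
    have "?L ?f \<le> ?L (\<lambda>x. s x + ?G M x)"
      using p by (intro power_mean_mono finite_measure_sphere_measure bf bdd_measurable_add s(1) bG,
        simp, use close[of M] in \<open>eventually_elim, linarith\<close>)
    also have "\<dots> \<le> ?L s + ?L (?G M)"
      by (intro power_mean_triangle finite_measure_sphere_measure s(1) bG p)
    finally show "?L ?f \<le> ?L s + \<eta> * ?L ?f + ?y ^ Suc M / fact (Suc M) * (C * ?L (\<lambda>_. 1))"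
      using LG[of M] by linarith
  qed
  then show "(1 - \<eta>) * ?L ?f \<le> power_mean (discretized_measure \<Xi> \<Z>) p ?f"
    by (simp add: s(3) left_diff_distrib)
  have "?L s \<le> ?L ?f + \<eta> * ?L ?f"
  proof (rule le_of_power_fact_error)
    fix M
    have "?L s \<le> ?L (\<lambda>x. ?f x + ?G M x)"
      using p by (intro power_mean_mono finite_measure_sphere_measure bf bdd_measurable_add s(1) bG,
        simp, use close[of M] in \<open>eventually_elim, linarith\<close>)
    also have "\<dots> \<le> ?L ?f + ?L (?G M)"
      by (intro power_mean_triangle finite_measure_sphere_measure bf bG p)
    finally show "?L s \<le> ?L ?f + \<eta> * ?L ?f + ?y ^ Suc M / fact (Suc M) * (C * ?L (\<lambda>_. 1))"
      using LG[of M] by linarith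
  qed
  then show "power_mean (discretized_measure \<Xi> \<Z>) p ?f \<le> (1 + \<eta>) * ?L ?f"
    by (simp add: s(3) distrib_right)
qed

section \<open>The case of the sup norm\<close>

lemma patch_measure_pos:
  assumes "\<xi> \<in> sphere_interior Z" "Z \<in> sets sphere_measure"
  shows "emeasure sphere_measure Z > 0"
proof -
  obtain T where T: "openin (top_of_set (sphere 0 1)) T" "\<xi> \<in> T" "T \<subseteq> Z"
    using assms(1) unfolding sphere_interior_def interior_of_def by blast
  then obtain U where U: "open U" "T = U \<inter> sphere 0 1"
    by (metis Int_commute openin_open)
  then have "U \<inter> sphere 0 1 \<noteq> {}"
    using T(2) by blast
  then have "0 < emeasure sphere_measure T"
    unfolding U(2) by (rule emeasure_sphere_measure_open_pos[OF U(1)])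
  also have "\<dots> \<le> emeasure sphere_measure Z"
    using T(3) assms(2) by (rule emeasure_mono)
  finally show ?thesis .
qed

text \<open>Every node lies in the interior of its patch and hence has positive mass, so a null set
  contains no node. The essential supremum thereby becomes the maximum over
  \<open>\<Xi>\<close>.\<close>

lemma AE_discretized_measure_iff:
  fixes \<Z> :: "(real ^ 'd) set set"
  assumes cp: "compatible_pair \<Xi> \<Z>" and Q: "{x\<in>sphere 0 1. \<not> Q x} \<in> sets sphere_measure"
  shows "(AE x in discretized_measure \<Xi> \<Z>. Q x) \<longleftrightarrow> (\<forall>\<xi>\<in>\<Xi>. Q \<xi>)"
proof -
  let ?N = "{x\<in>sphere 0 1. \<not> Q x}"
  have \<Xi>: "finite \<Xi>" "\<Xi> \<subseteq> sphere 0 1" and part: "sphere_partition \<Z>"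
    using cp by (simp_all add: compatible_pair_def)
  obtain z where nodes: "patch_nodes \<Xi> \<Z> z"
    using compatible_pair_patch_nodes[OF cp] by blast
  note z = patch_nodesD[OF nodes]
  have pos: "emeasure sphere_measure (patch_of \<Z> \<xi>) \<noteq> 0" if "\<xi> \<in> \<Xi>" for \<xi>
  proof -
    obtain Z where Z: "Z \<in> \<Z>" "\<xi> = z Z"
      using z(1) \<open>\<xi> \<in> \<Xi>\<close> by (auto simp: bij_betw_def)
    then have "Z \<in> sets sphere_measure"
      using sphere_partitionD(2)[OF part] by blast
    then show ?thesis
      using patch_measure_pos[OF z(3)[OF Z(1)]] z(4)[OF Z(1)] unfolding Z(2) by simp
  qed
  have space: "space (discretized_measure \<Xi> \<Z>) = sphere 0 1"
    and sets: "sets (discretized_measure \<Xi> \<Z>) = sets sphere_measure"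
    by (simp_all add: discretized_measure_def space_sphere_measure)
  have "(AE x in discretized_measure \<Xi> \<Z>. Q x) \<longleftrightarrow> emeasure (discretized_measure \<Xi> \<Z>) ?N = 0"
    using Q by (intro AE_iff_measurable) (simp_all add: space sets)
  also have "\<dots> \<longleftrightarrow> (\<forall>\<xi>\<in>\<Xi>. Q \<xi>)"
    unfolding emeasure_discretized_measure[OF \<Xi> Q]
    using \<Xi> pos by (auto simp: sum_eq_0_iff indicator_def)
  finally show ?thesis .
qed

lemma discretized_sup_norm_bounds:
  fixes f :: "real ^ 'd \<Rightarrow> complex" and \<Z> :: "(real ^ 'd) set set"
  assumes cp: "compatible_pair \<Xi> \<Z>" and f: "circle_trig n f"
    and h: "0 \<le> partition_norm \<Z>" "partition_norm \<Z> < pi"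
    and \<eta>: "2 * (partition_norm \<Z> * (real (card (coord_planes :: ('d \<times> 'd) set)) * real n)) \<le> \<eta>" "0 \<le> \<eta>"
  shows "(1 - \<eta>) * Lp_norm sphere_measure \<infinity> f \<le> Lp_norm (discretized_measure \<Xi> \<Z>) \<infinity> f"
    and "Lp_norm (discretized_measure \<Xi> \<Z>) \<infinity> f \<le> (1 + \<eta>) * Lp_norm sphere_measure \<infinity> f"
proof -
  let ?D = "discretized_measure \<Xi> \<Z>" and ?S = "sphere_measure :: (real ^ 'd) measure"
  let ?h = "partition_norm \<Z>"
  define A where "A = Lp_norm ?S \<infinity> f"
  define B where "B = Lp_norm ?D \<infinity> f"
  have part: "sphere_partition \<Z>" and \<Xi>: "\<Xi> \<subseteq> sphere 0 1"
    using cp by (simp_all add: compatible_pair_def)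
  obtain z where nodes: "patch_nodes \<Xi> \<Z> z"
    using compatible_pair_patch_nodes[OF cp] by blast
  note z = patch_nodesD[OF nodes]
  have cont: "continuous_on U f" for U
    by (rule circle_trig_continuous_on[OF f])
  obtain C0 where C0: "\<And>x. x \<in> sphere 0 1 \<Longrightarrow> cmod (f x) \<le> C0"
    using circle_trig_bounded[OF f] by blast
  have fm: "f \<in> borel_measurable ?S"
    by (rule borel_measurable_sphere_measure[OF cont])
  have op: "open {x. c < cmod (f x)}" for c
    using cont[of UNIV] by (intro open_Collect_less continuous_on_norm continuous_on_const)
  have Nsets: "{x\<in>sphere 0 1. \<not> cmod (f x) \<le> c} \<in> sets ?S" for c
  proof -
    have "{x\<in>sphere 0 1. \<not> cmod (f x) \<le> c} = {x. c < cmod (f x)} \<inter> sphere 0 1"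
      by auto
    then show ?thesis
      using op[of c] by (simp only:) (intro sets_sphere_measure_borel, auto)
  qed
  have spaceD: "space ?D = sphere 0 1" and setsD: "sets ?D = sets ?S"
    by (simp_all add: discretized_measure_def space_sphere_measure)
  have fmD: "f \<in> borel_measurable ?D"
    using fm by (simp add: measurable_cong_sets[OF setsD refl])
  \<comment> \<open>Any coordinate index; its basis vector shows that the sphere is nonempty, and
    hence so are the partition and \<open>\<Xi>\<close>.\<close>
  obtain i :: 'd where True by blast
  have ne: "axis i 1 \<in> (sphere 0 1 :: (real ^ 'd) set)"
    by simp
  then obtain Z0 where Z0: "Z0 \<in> \<Z>"
    using sphere_partitionD(3)[OF part] by blast
  then have \<Xi>ne: "z Z0 \<in> \<Xi>"
    by (rule z(5))
  have neS: "emeasure ?S (space ?S) \<noteq> 0"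
    using emeasure_sphere_measure_open_pos[of "UNIV :: (real ^ 'd) set"] ne
    by (auto simp: space_sphere_measure)
  have neD: "emeasure ?D (space ?D) \<noteq> 0"
  proof
    assume "emeasure ?D (space ?D) = 0"
    then have "AE x in ?D. False"
      by (subst AE_iff_measurable[of "space ?D"]) auto
    moreover have "{x \<in> sphere 0 1 :: (real ^ 'd) set. \<not> False} \<in> sets ?S"
    proof -
      have "{x \<in> sphere 0 1 :: (real ^ 'd) set. \<not> False} = space ?S"
        unfolding space_sphere_measure by blast
      then show ?thesis by (simp only: sets.top)
    qed
    ultimately show False
      using AE_discretized_measure_iff[OF cp, of "\<lambda>_. False"] \<Xi>ne by simp
  qed
  \<comment> \<open>By continuity, exceeding the essential supremum at one point means exceeding it
    on a relatively open set, which has positive measure.\<close>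
  have boundA: "cmod (f x) \<le> A" if x: "x \<in> sphere 0 1" for x
  proof (rule ccontr)
    assume "\<not> cmod (f x) \<le> A"
    then have "x \<in> {x. A < cmod (f x)} \<inter> sphere 0 1"
      using x by simp
    then have "{x. A < cmod (f x)} \<inter> sphere 0 1 \<noteq> {}"
      by blast
    then have "0 < emeasure ?S ({x. A < cmod (f x)} \<inter> sphere 0 1)"
      by (rule emeasure_sphere_measure_open_pos[OF op])
    moreover have "AE x in ?S. cmod (f x) \<le> A"
      unfolding A_def using C0 by (intro Lp_norm_infinity(1)[OF fm _ neS, of C0]) (simp add: space_sphere_measure)
    then have "emeasure ?S {x \<in> sphere 0 1. \<not> cmod (f x) \<le> A} = 0"
      using Nsets[of A] AE_iff_measurable[of "{x \<in> sphere 0 1. \<not> cmod (f x) \<le> A}" ?S]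
      by (simp add: space_sphere_measure)
    moreover have "{x \<in> sphere 0 1. \<not> cmod (f x) \<le> A} = {x. A < cmod (f x)} \<inter> sphere 0 1"
      by auto
    ultimately show False by simp
  qed
  have A0: "0 \<le> A"
    using boundA[OF ne] norm_ge_zero order_trans by blast
  have "AE x in ?D. cmod (f x) \<le> B"
    unfolding B_def using C0 by (intro Lp_norm_infinity(1)[OF fmD _ neD, of C0]) (simp add: spaceD)
  then have boundB: "cmod (f \<xi>) \<le> B" if "\<xi> \<in> \<Xi>" for \<xi>
    using AE_discretized_measure_iff[OF cp Nsets[of B]] that by blast
  have "B \<le> A"
    unfolding B_def
  proof (rule Lp_norm_infinity(2)[OF fmD _ neD, of C0])
    show "AE x in ?D. cmod (f x) \<le> A"
      using AE_discretized_measure_iff[OF cp Nsets[of A]] boundA \<Xi> by blast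
  qed (simp add: spaceD C0)
  also have "A \<le> (1 + \<eta>) * A"
    using A0 \<eta>(2) by (simp add: distrib_right)
  finally show "Lp_norm ?D \<infinity> f \<le> (1 + \<eta>) * Lp_norm ?S \<infinity> f"
    by (simp add: A_def B_def)
  have "A \<le> B + \<eta> * A"
    unfolding A_def
  proof (rule Lp_norm_infinity(2)[OF fm _ neS, of C0], unfold A_def[symmetric])
    have "cmod (f x) \<le> B + \<eta> * A" if x: "x \<in> sphere 0 1" for x
    proof -
      obtain Z where Z: "Z \<in> \<Z>" "x \<in> Z"
        using sphere_partitionD(3)[OF part] x by blast
      have zZ: "z Z \<in> \<Xi>"
        using Z(1) by (rule z(5))
      \<comment> \<open>With \<open>M = 0\<close> the bound is just its remainder
        \<open>h K n A\<close>, which is already a multiple of the norm to be compared with.\<close>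
      have "cmod (f (z Z) - f x) \<le> taylor_bound n 0 f x A ?h"
        using zZ \<Xi>
        by (intro geodesic_taylor_bound[OF f boundA x] h(2)
            geodesic_dist_le_partition_norm[OF part Z z(2)[OF Z(1)]]) blast+
      also have "\<dots> \<le> \<eta> * A"
      proof -
        have "0 \<le> ?h * (real (card (coord_planes :: ('d \<times> 'd) set)) * real n)"
          using h by simp
        then have "?h * (real (card (coord_planes :: ('d \<times> 'd) set)) * real n) \<le> \<eta>"
          using \<eta>(1) by linarith
        then show ?thesis
          using A0 mult_right_mono by (fastforce simp: taylor_bound_def mult.assoc)
      qed
      finally show ?thesis
        using boundB[OF zZ] norm_triangle_ineq3[of "f (z Z)" "f x"] by linarith
    qed
    then show "AE x in ?S. cmod (f x) \<le> B + \<eta> * A"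
      by (intro AE_I2) (simp add: space_sphere_measure)
  qed (simp add: space_sphere_measure C0)
  then show "(1 - \<eta>) * Lp_norm ?S \<infinity> f \<le> Lp_norm ?D \<infinity> f"
    by (simp add: A_def[symmetric] B_def[symmetric] left_diff_distrib)
qed

text \<open>Agreement on the whole space makes both functions measurable or neither; in the latter
  case the essential supremum is the same default value.\<close>

lemma Lp_norm_cong:
  assumes "\<And>x. x \<in> space M \<Longrightarrow> f x = g x"
  shows "Lp_norm M p f = Lp_norm M p g"
proof (cases "p = \<infinity>")
  case True
  let ?u = "\<lambda>x. ereal (cmod (f x))" and ?v = "\<lambda>x. ereal (cmod (g x))"
  have "?u \<in> borel_measurable M \<longleftrightarrow> ?v \<in> borel_measurable M"
    using assms by (intro measurable_cong) simp
  moreover have "esssup M ?u = esssup M ?v" if "?u \<in> borel_measurable M" "?v \<in> borel_measurable M"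
    using that assms by (intro esssup_AE_cong AE_I2) auto
  ultimately have "esssup M ?u = esssup M ?v"
    using esssup_non_measurable[of ?u M] esssup_non_measurable[of ?v M] by fastforce
  then show ?thesis using True by (simp add: Lp_norm_def)
next
  case False
  have "(\<integral>x. cmod (f x) powr real_of_ereal p \<partial>M) = (\<integral>x. cmod (g x) powr real_of_ereal p \<partial>M)"
    using assms by (intro Bochner_Integration.integral_cong) auto
  then show ?thesis using False by (simp add: Lp_norm_def)
qed

theorem theorem4p1:
  fixes q n :: nat and \<eta> :: real
    and \<Xi> :: "(real ^ 'd) set" and \<Z> :: "(real ^ 'd) set set"
    and p :: ereal and P :: "real ^ 'd \<Rightarrow> complex"
  assumes "CARD('d) = q + 1" and "2 \<le> q"
    and "0 < \<eta>" and "\<eta> < 1"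
    and "compatible_pair \<Xi> \<Z>"
    and "5 * C_const q * (real n + (real q)\<^sup>2) * partition_norm \<Z> \<le> \<eta>"
    and "1 \<le> p"
    and "P \<in> harmonics_upto n"
  shows "(1 - \<eta>) * Lp_norm sphere_measure p P \<le> Lp_norm (discretized_measure \<Xi> \<Z>) p P \<and>
         Lp_norm (discretized_measure \<Xi> \<Z>) p P \<le> (1 + \<eta>) * Lp_norm sphere_measure p P"
proof -
  let ?h = "partition_norm \<Z>" and ?K = "real (card (coord_planes :: ('d \<times> 'd) set))"
  obtain f where f: "circle_trig n f" and Pf: "\<And>x. x \<in> sphere 0 1 \<Longrightarrow> P x = f x"
    using harmonics_upto_circle_trig[OF assms(8)] by blast
  have part: "sphere_partition \<Z>"
    using assms(5) by (simp add: compatible_pair_def)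
  obtain i :: 'd where True by blast
  have "axis i 1 \<in> (sphere 0 1 :: (real ^ 'd) set)"
    by simp
  then obtain Z where Z: "Z \<in> \<Z>" "axis i 1 \<in> Z"
    using sphere_partitionD(3)[OF part] by blast
  \<comment> \<open>The supremum includes the distance of a point to itself,
    \<open>arccos 1 = 0\<close>.\<close>
  have h0: "0 \<le> ?h"
    using geodesic_dist_le_partition_norm[OF part Z(1) Z(2) Z(2)]
    by (simp add: geodesic_dist_def inner_axis_axis)
  have KC: "2 * ?K \<le> 5 * C_const q"
    using card_coord_planes_le[OF assms(1)] C_const_bound[of q] by linarith
  have C2: "2 \<le> 5 * C_const q"
    using C_const_bound[of q] one_le_power[of "real q + 1" 2] by linarith
  have q1: "1 \<le> (real q)\<^sup>2"
    using assms(2) power_mono[of 1 "real q" 2] by simp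
  have "2 * (?h * (?K * real n)) = (2 * ?K) * real n * ?h"
    by simp
  also have "\<dots> \<le> (5 * C_const q) * (real n + (real q)\<^sup>2) * ?h"
    using C2 by (intro mult_right_mono[OF mult_mono[OF KC]] h0) auto
  finally have \<eta>: "2 * (?h * (?K * real n)) \<le> \<eta>"
    using assms(6) by simp
  \<comment> \<open>The factor in front of the partition norm is at least 1, for
    \<open>n = 0\<close> thanks to the summand \<open>q^2\<close>. Hence
    \<open>?h \<le> \<eta> < 1 < pi\<close>, and no patch contains antipodal points.\<close>
  have "1 * ?h \<le> (5 * C_const q * (real n + (real q)\<^sup>2)) * ?h"
  proof (rule mult_right_mono[OF _ h0])
    have "1 * 1 \<le> 5 * C_const q * (real n + (real q)\<^sup>2)"
      using C2 q1 by (intro mult_mono) auto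
    then show "1 \<le> 5 * C_const q * (real n + (real q)\<^sup>2)" by simp
  qed
  then have hpi: "?h < pi"
    using assms(4,6) pi_gt3 by linarith
  have norms: "Lp_norm sphere_measure p P = Lp_norm sphere_measure p f"
    "Lp_norm (discretized_measure \<Xi> \<Z>) p P = Lp_norm (discretized_measure \<Xi> \<Z>) p f"
    by (rule Lp_norm_cong; simp add: discretized_measure_def space_sphere_measure Pf)+
  have "(1 - \<eta>) * Lp_norm sphere_measure p f \<le> Lp_norm (discretized_measure \<Xi> \<Z>) p f \<and>
      Lp_norm (discretized_measure \<Xi> \<Z>) p f \<le> (1 + \<eta>) * Lp_norm sphere_measure p f"
  proof (cases "p = \<infinity>")
    case True
    show ?thesis
      unfolding True
      using discretized_sup_norm_bounds[OF assms(5) f h0 hpi \<eta>] assms(3) by simp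
  next
    case False
    then obtain r where r: "p = ereal r" "1 \<le> r"
      using assms(7) by (cases p) auto
    show ?thesis
      unfolding r(1) Lp_norm_eq_power_mean
      using discretized_power_mean_bounds[OF assms(5) f r(2) h0 hpi \<eta> assms(4)] by simp
  qed
  then show ?thesis
    by (simp only: norms)
qed

end
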